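(* Let $F$ be a Ferrers diagram. The map $M$ sending a tree-tableau $\mathcal{T}$ of shape $F$ to $\Psi^{-1}(\tau(\mathcal{T}))$ is a bijection from the set of tree-tableaux of shape $F$ to the set of EW-tableaux of shape $F$.
   Context: A Ferrers diagram is a left-aligned array of cells whose row lengths weakly decrease from top to bottom (all rows nonempty). Labels: traverse the southeast border of $F$ from the northeast corner to the southwest corner and number its unit steps $0,1,\dots,n$, where $n+1$ = (number of rows)+(number of columns); the vertical step at the right end of a row is that row's label, the horizontal step at the bottom of a column is that column's label. The top row has label 0. Both tree-tableaux and EW-tableaux of shape $F$ have size $n$. A tree-tableau of shape $F$ is a filling of $F$ in which each cell is empty or contains a dot, such that (1) the top left cell has a dot; (2) every other dotted cell has a dot above it in the same column or a dot to its left in the same row, but not both; (3) every row and every column has a dot. An EW-tableau of shape $F$ is a 0/1-filling of $F$ such that (1) the top row is all 1s; (2) every other row has at least one 0; (3) no four cells forming the corners of a rectangle have 0s in two diagonally opposite corners and 1s in the other two. The permutation $\tau(\mathcal{T})=v_1v_2\dots v_n$ of a tree-tableau $\mathcal{T}$: set $v_0=0$ (the top row). For $i=1,2,\dots,n$ in turn: let $j$ be the largest index in $\{0,\dots,i-1\}$ such that the row or column labeled $v_j$ contains a dotted cell not in $\{e_1,\dots,e_{i-1}\}$; let $e_i$ be the bottommost (if $v_j$ labels a column), respectively rightmost (if $v_j$ labels a row), such dotted cell in $v_j$; let $v_i$ be the label of the row or column of $e_i$ that is not in $\{v_0,\dots,v_{i-1}\}$. The map $\Psi$, a bijection from EW-tableaux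 of size $n$ (of all shapes) to permutations of $\{1,\dots,n\}$, where the size is (number of rows)+(number of columns)$-1$: delete all entries of the top row and disregard the label 0. Repeat until all labels have been read: (i) write down the labels of all unread columns containing no 1s, from right to left, and delete their entries; (ii) write down the labels of all unread rows containing no 0s, from bottom to top, and delete their entries. The resulting word is the image under $\Psi$. *)

theory Defs
  imports "HOL-Library.FuncSet" "HOL-Library.While_Combinator"
begin

text \<open>
  A Ferrers diagram is given by its list of row lengths, from top to bottom. Rows and columns are
  numbered from 0, from top to bottom and from left to right; the cell \<open>(r, c)\<close> lies
  in row \<open>r\<close> and column \<open>c\<close>. The empty diagram is excluded.
\<close>

definition ferrers :: "nat list \<Rightarrow> bool" where
  "ferrers F \<longleftrightarrow> F \<noteq> [] \<and> sorted_wrt (\<ge>) F \<and> (\<forall>k\<in>set F. 0 < k)"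

definition nrows :: "nat list \<Rightarrow> nat" where
  "nrows F = length F"

definition ncols :: "nat list \<Rightarrow> nat" where
  "ncols F = F ! 0"

definition tab_size :: "nat list \<Rightarrow> nat" where
  "tab_size F = nrows F + ncols F - 1"

definition cells :: "nat list \<Rightarrow> (nat \<times> nat) set" where
  "cells F = {(r, c). r < nrows F \<and> c < F ! r}"

datatype line = Row nat | Col nat

text \<open>
  The unit steps of the southeast border from the northeast to the southwest corner, each step
  being represented by the row or column whose label it carries: the vertical step of row
  \<open>r\<close> is followed by the horizontal steps below those columns that end in row
  \<open>r\<close>, from right to left.
\<close>

definition border :: "nat list \<Rightarrow> line list" where
  "border F = concat (map (\<lambda>r. Row r #
       map Col (rev [(if Suc r < nrows F then F ! Suc r else 0) ..< F ! r])) [0..<nrows F])"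

definition label :: "nat list \<Rightarrow> line \<Rightarrow> nat" where
  "label F l = (THE i. i < length (border F) \<and> border F ! i = l)"

fun line_cells :: "line \<Rightarrow> (nat \<times> nat) set" where
  "line_cells (Row r) = {r} \<times> UNIV"
| "line_cells (Col c) = UNIV \<times> {c}"

text \<open>A tree-tableau is represented by its set of dotted cells.\<close>

definition tree_tableaux :: "nat list \<Rightarrow> (nat \<times> nat) set set" where
  "tree_tableaux F = {D. D \<subseteq> cells F \<and>
     (0, 0) \<in> D \<and>
     (\<forall>(r, c)\<in>D. (r, c) \<noteq> (0, 0) \<longrightarrow>
        ((\<exists>r'<r. (r', c) \<in> D) \<noteq> (\<exists>c'<c. (r, c') \<in> D))) \<and>
     (\<forall>r<nrows F. \<exists>c. (r, c) \<in> D) \<and>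
     (\<forall>c<ncols F. \<exists>r. (r, c) \<in> D)}"

type_synonym filling = "nat \<times> nat \<Rightarrow> nat"

text \<open>In the last condition, \<open>(r', c')\<close> is the bottom right corner of the rectangle; if it
  lies in the diagram then so do the other three corners.\<close>

definition EW_tableaux :: "nat list \<Rightarrow> filling set" where
  "EW_tableaux F = {T \<in> cells F \<rightarrow>\<^sub>E {0, 1}.
     (\<forall>c<ncols F. T (0, c) = 1) \<and>
     (\<forall>r. 0 < r \<and> r < nrows F \<longrightarrow> (\<exists>c<F ! r. T (r, c) = 0)) \<and>
     (\<forall>r r' c c'. r < r' \<and> c < c' \<and> (r', c') \<in> cells F \<longrightarrow>
        \<not> (T (r, c) = 0 \<and> T (r', c') = 0 \<and> T (r, c') = 1 \<and> T (r', c) = 1) \<and>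
        \<not> (T (r, c) = 1 \<and> T (r', c') = 1 \<and> T (r, c') = 0 \<and> T (r', c) = 0))}"

text \<open>EW-tableaux of size \<open>n\<close> of all shapes, as pairs of a shape and a filling.\<close>

definition EW_tableaux_of_size :: "nat \<Rightarrow> (nat list \<times> filling) set" where
  "EW_tableaux_of_size n = {(F, T). ferrers F \<and> tab_size F = n \<and> T \<in> EW_tableaux F}"

text \<open>
  \<open>tau_state F D i\<close> is the pair of lists \<open>([v\<^sub>0, \<dots>, v\<^sub>i], [e\<^sub>1, \<dots>, e\<^sub>i])\<close>.
  The line labeled \<open>v\<close> is \<open>border F ! v\<close>.
\<close>

definition unused_dots ::
    "nat list \<Rightarrow> (nat \<times> nat) set \<Rightarrow> (nat \<times> nat) list \<Rightarrow> nat \<Rightarrow> (nat \<times> nat) set" where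
  "unused_dots F D es v = (D \<inter> line_cells (border F ! v)) - set es"

fun outermost :: "line \<Rightarrow> (nat \<times> nat) set \<Rightarrow> nat \<times> nat" where
  "outermost (Row r) X = (r, Max {c. (r, c) \<in> X})"
| "outermost (Col c) X = (Max {r. (r, c) \<in> X}, c)"

primrec tau_state ::
    "nat list \<Rightarrow> (nat \<times> nat) set \<Rightarrow> nat \<Rightarrow> nat list \<times> (nat \<times> nat) list" where
  "tau_state F D 0 = ([0], [])"
| "tau_state F D (Suc i) =
     (let (vs, es) = tau_state F D i;
          j = Max {j. j < Suc i \<and> unused_dots F D es (vs ! j) \<noteq> {}};
          e = outermost (border F ! (vs ! j)) (unused_dots F D es (vs ! j));
          v = (THE v. v \<in> {label F (Row (fst e)), label F (Col (snd e))} \<and> v \<notin> set vs)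
      in (vs @ [v], es @ [e]))"

definition tau :: "nat list \<Rightarrow> (nat \<times> nat) set \<Rightarrow> nat list" where
  "tau F D = tl (fst (tau_state F D (tab_size F)))"

text \<open>
  For the map \<open>Psi\<close>, \<open>w\<close> is the word of the labels read so far. The cells
  whose entries have not been deleted are those outside the top row whose row and column are both
  unread.
\<close>

definition remaining :: "nat list \<Rightarrow> nat list \<Rightarrow> (nat \<times> nat) set" where
  "remaining F w = {(r, c) \<in> cells F. r \<noteq> 0 \<and>
     label F (Row r) \<notin> set w \<and> label F (Col c) \<notin> set w}"

definition read_cols :: "nat list \<Rightarrow> filling \<Rightarrow> nat list \<Rightarrow> nat list" where
  "read_cols F T w = w @ [label F (Col c). c \<leftarrow> rev [0..<ncols F],
     label F (Col c) \<notin> set w \<and> \<not> (\<exists>r. (r, c) \<in> remaining F w \<and> T (r, c) = 1)]"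

definition read_rows :: "nat list \<Rightarrow> filling \<Rightarrow> nat list \<Rightarrow> nat list" where
  "read_rows F T w = w @ [label F (Row r). r \<leftarrow> rev [1..<nrows F],
     label F (Row r) \<notin> set w \<and> \<not> (\<exists>c. (r, c) \<in> remaining F w \<and> T (r, c) = 0)]"

definition Psi :: "nat list \<times> filling \<Rightarrow> nat list" where
  "Psi = (\<lambda>(F, T). while (\<lambda>w. length w < tab_size F) (\<lambda>w. read_rows F T (read_cols F T w)) [])"

definition Psi_inv :: "nat \<Rightarrow> nat list \<Rightarrow> nat list \<times> filling" where
  "Psi_inv n = inv_into (EW_tableaux_of_size n) Psi"

definition M :: "nat list \<Rightarrow> (nat \<times> nat) set \<Rightarrow> nat list \<times> filling" where
  "M F D = Psi_inv (tab_size F) (tau F D)"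

end

theory Submission
  imports Defs
begin

text \<open>
  Number the lines of the diagram by their labels \<open>0, \<dots>, n\<close>. A row \<open>a\<close> and a
  column \<open>b\<close> meet in a cell exactly if \<open>a < b\<close>. Both kinds of tableaux of shape
  \<open>F\<close> are encoded by the same set of words, called \<open>border_words\<close> below: the
  permutations of \<open>{0..n}\<close> that start with \<open>0\<close> and in which each later letter is a
  column exactly if it is larger than its predecessor.

  An EW-tableau orients every cell: the row precedes the column if the entry is 1, and the column
  precedes the row if it is 0. The rectangle condition forbids oriented cycles of length four, and
  in a Ferrers diagram this forbids all cycles (\<open>EW_source_exists\<close>). Hence the reading
  process never gets stuck, and the word that it produces is a linear order compatible with the
  orientation. It consists of alternating monotone blocks of columns and of rows. After the first
  block, every line of a new block was held back by a line of the block just read, hence forms a cell with it, and this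
  compares the two blocks as the zigzag condition demands (\<open>reading_step\<close>). Conversely,
  a border word is determined by the relative order of its letters that form cells
  (\<open>border_word_eqI\<close>). So the entries of the tableau and its word determine each other,
  and every border word arises.

  In a tree-tableau every line except the top row owns one dot: the leftmost one of a row, the
  topmost one of a column. Let \<open>par x\<close> be the other line through the dot of \<open>x\<close>.
  This makes the lines a tree with root \<open>0\<close>, and the condition on dots above and to the
  left says precisely that \<open>x\<close> lies strictly between \<open>par x\<close> and
  \<open>par (par x)\<close> unless \<open>par x\<close> is the root (\<open>nested\<close>, \<open>tree_of_tree_tableau\<close>,
  \<open>tree_tableau_tree_of\<close>). The map \<open>tau\<close> is a depth-first search of this tree that
  takes the children of a line in the order of their distance from it. Because of the nesting, all
  letters written between \<open>par x\<close> and \<open>x\<close> have values strictly between these two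
  numbers (\<open>traverses\<close>, \<open>depth_first_between\<close>). This property makes the word a
  border word, and it allows one to recover the tree from the word and the word from the tree
  (\<open>parent_unique\<close>, \<open>traversal_unique\<close>). Every border word has such a tree: the
  parent of \<open>x\<close> is the extreme letter of the run of letters on the parent's side of
  \<open>x\<close> that ends just before \<open>x\<close> (\<open>border_word_traverses\<close>).

  So \<open>tau\<close> and \<open>Psi\<close> both map onto the border words of \<open>F\<close>. It remains to see
  that inverting \<open>Psi\<close> over all shapes of size \<open>n\<close> returns the shape \<open>F\<close>:
  the ascents of a border word show which labels are columns, and these determine the diagram
  (\<open>ferrers_eqI\<close>).
\<close>

section \<open>Words that zigzag between rows and columns\<close>

text \<open>
  Rows and columns play symmetric roles once the order of the labels is reversed. To treat both
  kinds at once, the order carries the kind as an argument: with \<open>k\<close> true (columns) it is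
  the usual order, with \<open>k\<close> false (rows) the reverse one. In either case the lines that
  meet a line \<open>x\<close> in a cell lie below \<open>x\<close>.
\<close>

definition below :: "bool \<Rightarrow> nat \<Rightarrow> nat \<Rightarrow> bool" where
  "below k x y \<longleftrightarrow> (if k then x < y else y < x)"

lemma below_irrefl [simp]: "\<not> below k x x"
  by (simp add: below_def)

lemma below_trans: "below k x y \<Longrightarrow> below k y z \<Longrightarrow> below k x z"
  by (auto simp: below_def split: if_splits)

lemma below_asym: "below k x y \<Longrightarrow> \<not> below k y x"
  by (auto simp: below_def split: if_splits)

lemma below_opposite: "below k x y \<Longrightarrow> below k' y x \<Longrightarrow> k' \<longleftrightarrow> \<not> k"
  by (auto simp: below_def split: if_splits)

lemma below_linear: "x \<noteq> y \<Longrightarrow> below k x y \<or> below k y x"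
  by (auto simp: below_def)

lemma below_flip: "below (\<not> k) x y \<longleftrightarrow> below k y x"
  by (auto simp: below_def)

lemma below_least:
  assumes "finite A" "A \<noteq> {}"
  obtains x where "x \<in> A" "\<And>y. y \<in> A \<Longrightarrow> y \<noteq> x \<Longrightarrow> below k x y"
proof (cases k)
  case True
  then show thesis
    using that[of "Min A"] assms
    by (metis Min_in Min_le below_def le_neq_implies_less)
next
  case False
  then show thesis
    using that[of "Max A"] assms
    by (metis Max_in Max_ge below_def le_neq_implies_less)
qed

definition before :: "'a list \<Rightarrow> 'a \<Rightarrow> 'a \<Rightarrow> bool" where
  "before v a b \<longleftrightarrow> (\<exists>i j. i < j \<and> j < length v \<and> v ! i = a \<and> v ! j = b)"

lemma before_nthI: "i < j \<Longrightarrow> j < length v \<Longrightarrow> before v (v ! i) (v ! j)"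
  unfolding before_def by blast

lemma before_trans:
  assumes "distinct v" "before v a b" "before v b c"
  shows "before v a c"
  using assms unfolding before_def by (metis nth_eq_iff_index_eq order_less_trans)

lemma before_asym:
  assumes "distinct v" "before v a b"
  shows "\<not> before v b a"
  using assms unfolding before_def
  by (metis nth_eq_iff_index_eq order_less_trans order_less_irrefl)

lemma before_total:
  assumes "a \<in> set v" "b \<in> set v" "a \<noteq> b"
  shows "before v a b \<or> before v b a"
  using assms unfolding before_def by (metis in_set_conv_nth nat_neq_iff)

text \<open>
  The border as a sequence of steps: all that matters about a label is whether its step is
  horizontal. The first step always belongs to the top row and the last one to the leftmost column.
\<close>

locale border_steps =
  fixes n :: nat and col :: "nat \<Rightarrow> bool"
  assumes not_col_0: "\<not> col 0" and col_n: "col n"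
begin

lemma n_pos: "0 < n"
  using not_col_0 col_n by (cases n) auto

text \<open>
  Unfolding the order: a letter that is a column exceeds its predecessor, a letter that is a row is
  smaller than its predecessor.
\<close>

definition zigzag :: "nat list \<Rightarrow> bool" where
  "zigzag v \<longleftrightarrow> (\<forall>i. Suc i < length v \<longrightarrow> below (col (v ! Suc i)) (v ! i) (v ! Suc i))"

definition rooted_perm :: "nat list \<Rightarrow> bool" where
  "rooted_perm v \<longleftrightarrow> length v = Suc n \<and> distinct v \<and> set v = {..n} \<and> v ! 0 = 0"

definition border_words :: "nat list set" where
  "border_words = {v. rooted_perm v \<and> zigzag v}"

lemma rooted_permI:
  assumes "distinct v" "set v \<subseteq> {..n}" "Suc n \<le> length v" "v ! 0 = 0"
  shows "rooted_perm v"
proof -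
  have c: "card (set v) = length v" using assms(1) distinct_card by blast
  have "card (set v) \<le> Suc n" using card_mono[OF _ assms(2)] by simp
  then have l: "length v = Suc n" using c assms(3) by simp
  have "set v = {..n}" using card_subset_eq[OF _ assms(2)] c l by simp
  then show ?thesis using l assms by (simp add: rooted_perm_def)
qed

lemma rooted_perm_nth_le: "rooted_perm v \<Longrightarrow> i \<le> n \<Longrightarrow> v ! i \<le> n"
  unfolding rooted_perm_def by (metis atMost_iff le_imp_less_Suc nth_mem)

lemma rooted_perm_nth_pos: "rooted_perm v \<Longrightarrow> 0 < i \<Longrightarrow> i \<le> n \<Longrightarrow> 0 < v ! i"
  unfolding rooted_perm_def
  by (metis le_imp_less_Suc nth_eq_iff_index_eq bot_nat_0.not_eq_extremum zero_less_Suc)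

lemma rooted_perm_nth_inj:
  "rooted_perm v \<Longrightarrow> i \<le> n \<Longrightarrow> j \<le> n \<Longrightarrow> v ! i = v ! j \<longleftrightarrow> i = j"
  unfolding rooted_perm_def by (metis le_imp_less_Suc nth_eq_iff_index_eq)

lemma rooted_perm_index:
  assumes "rooted_perm v" "x \<le> n"
  obtains i where "i \<le> n" "v ! i = x"
  using assms unfolding rooted_perm_def
  by (metis atMost_iff in_set_conv_nth less_Suc_eq_le)

lemma first_difference_half:
  assumes v: "rooted_perm v" and w: "rooted_perm w"
    and i: "i \<le> n" "\<forall>l<i. v ! l = w ! l" "v ! i \<noteq> w ! i"
  obtains j where "i < j" "j \<le> n" "v ! j = w ! i"
proof -
  obtain j where j: "j \<le> n" "v ! j = w ! i"
    using rooted_perm_index[OF v rooted_perm_nth_le[OF w i(1)]] by metis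
  have "\<not> j < i" using j i rooted_perm_nth_inj[OF w] by (metis nless_le)
  moreover have "j \<noteq> i" using j i by auto
  ultimately show thesis using that[of j] j by simp
qed

lemma first_difference:
  assumes "rooted_perm v" "rooted_perm w" "v \<noteq> w"
  obtains i j m where "0 < i" "i \<le> n" "\<forall>l<i. v ! l = w ! l" "v ! i \<noteq> w ! i"
    "i < j" "j \<le> n" "v ! j = w ! i" "i < m" "m \<le> n" "w ! m = v ! i"
proof -
  have "\<exists>i. i \<le> n \<and> v ! i \<noteq> w ! i"
    using assms unfolding rooted_perm_def by (metis less_Suc_eq_le nth_equalityI)
  then obtain i where i: "i \<le> n" "v ! i \<noteq> w ! i" "\<forall>l<i. v ! l = w ! l"
    using exists_least_iff[of "\<lambda>i. i \<le> n \<and> v ! i \<noteq> w ! i"]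
    by (metis less_imp_le_nat order_less_le_trans)
  have pos: "0 < i" using i assms by (cases i) (auto simp: rooted_perm_def)
  obtain j where "i < j" "j \<le> n" "v ! j = w ! i"
    using first_difference_half[OF assms(1,2) i(1,3,2)] by metis
  moreover obtain m where "i < m" "m \<le> n" "w ! m = v ! i"
    using first_difference_half[OF assms(2,1) i(1)] i by metis
  ultimately show thesis using that i pos by blast
qed

text \<open>
  If the word passes from a letter beyond \<open>w ! q\<close> to \<open>w ! q\<close> itself, it has to
  cross to the side from which \<open>w ! q\<close> is entered. The first letter after such a crossing
  was entered in the opposite direction, hence has the opposite kind.
\<close>

lemma zigzag_turn:
  assumes "zigzag w" "p < q" "q < length w" "below (col (w ! q)) (w ! q) (w ! p)"
  obtains m where "p < m" "m < q" "below (col (w ! q)) (w ! m) (w ! q)"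
    "col (w ! m) \<noteq> col (w ! q)"
proof -
  let ?k = "col (w ! q)"
  let ?P = "\<lambda>m. p < m \<and> below ?k (w ! m) (w ! q)"
  obtain q' where q': "q = Suc q'" using assms(2) by (cases q) auto
  have "below ?k (w ! q') (w ! q)" using assms q' by (simp add: zigzag_def)
  then have "?P q'" using assms q' below_asym by (metis less_SucE)
  then obtain m where m: "?P m" "\<forall>l<m. \<not> ?P l" "m \<le> q'"
    using exists_least_iff[of ?P] by (metis not_le_imp_less)
  obtain m' where m': "m = Suc m'" using m by (cases m) auto
  have "\<not> below ?k (w ! m') (w ! q)"
    using m m' assms(4) below_asym by (metis lessI less_SucE)
  then have "below ?k (w ! m) (w ! m')"
    using m(1) by (metis below_linear below_trans)
  moreover have "below (col (w ! m)) (w ! m') (w ! m)"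
    using assms m m' q' by (simp add: zigzag_def)
  ultimately have "col (w ! m) \<noteq> ?k" using below_opposite by blast
  then show thesis using that[of m] m q' by simp
qed

text \<open>
  Compare two words at the first place where they differ, and let \<open>x\<close>, \<open>y\<close> be the
  two letters there. If they have the same kind, take the nearer one, which in the other word comes
  later: there a letter that forms a cell with it stands in between, whereas in its own word the
  order is the opposite one. If the kinds differ, then both letters enter from the same common
  predecessor in opposite directions, so they form a cell themselves and their order differs.
\<close>

lemma border_word_eqI:
  assumes v: "v \<in> border_words" and w: "w \<in> border_words"
    and same: "\<And>a b. \<not> col a \<Longrightarrow> col b \<Longrightarrow> a < b \<Longrightarrow> b \<le> n \<Longrightarrow> before v a b \<longleftrightarrow> before w a b"
  shows "v = w"
proof (rule ccontr)
  assume "v \<noteq> w"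
  have pv: "rooted_perm v" "zigzag v" and pw: "rooted_perm w" "zigzag w"
    using v w by (auto simp: border_words_def)
  obtain i j m where i: "0 < i" "i \<le> n" "\<forall>l<i. v ! l = w ! l" "v ! i \<noteq> w ! i"
    and j: "i < j" "j \<le> n" "v ! j = w ! i" and m: "i < m" "m \<le> n" "w ! m = v ! i"
    by (rule first_difference[OF pv(1) pw(1) \<open>v \<noteq> w\<close>])
  have cell: "before v x y \<longleftrightarrow> before w x y"
    if "below (col y) x y" "col x \<noteq> col y" "x \<le> n" "y \<le> n"
    for x y
  proof (cases "col y")
    case True
    then show ?thesis using same that by (simp add: below_def)
  next
    case False
    then have "before v y x \<longleftrightarrow> before w y x" using same that by (simp add: below_def)
    moreover have "x \<in> set v" "y \<in> set v" "x \<in> set w" "y \<in> set w" "distinct v" "distinct w" "x \<noteq> y"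
      using that pv pw by (auto simp: rooted_perm_def)
    ultimately show ?thesis using before_total before_asym by metis
  qed
  \<comment> \<open>Two different letters of the same kind: the word in which the nearer one comes later must turn
    around before it reaches that letter, and the turning letter forms a cell with it.\<close>
  have same_kind: False
    if x: "rooted_perm x" and y: "rooted_perm y" "zigzag y" and eq: "\<forall>l<i. x ! l = y ! l"
      and nearer: "below (col (x ! i)) (x ! i) (y ! i)"
      and q: "i < q" "q \<le> n" "y ! q = x ! i"
      and c: "\<And>a b. below (col b) a b \<Longrightarrow> col a \<noteq> col b \<Longrightarrow> a \<le> n \<Longrightarrow> b \<le> n
        \<Longrightarrow> before x a b \<longleftrightarrow> before y a b"
    for x y q
  proof -
    have "q < length y" using q y by (simp add: rooted_perm_def)
    then obtain t where t: "i < t" "t < q" "below (col (y ! q)) (y ! t) (y ! q)"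
      "col (y ! t) \<noteq> col (y ! q)"
      using zigzag_turn[OF y(2) q(1)] nearer q(3) by metis
    have "before y (y ! t) (y ! q)"
      using before_nthI[OF t(2) \<open>q < length y\<close>] .
    moreover have "y ! t \<le> n" "y ! q \<le> n"
      using rooted_perm_nth_le[OF y(1), of t] rooted_perm_nth_le[OF y(1), of q] t(2) q(2)
      by simp_all
    ultimately have "before x (y ! t) (x ! i)" using c[OF t(3,4)] unfolding q(3) by blast
    \<comment> \<open>In \<open>x\<close> the turning letter would have to stand before position \<open>i\<close>, where both
      words agree.\<close>
    then obtain s where s: "s < i" "x ! s = y ! t"
      using x unfolding before_def rooted_perm_def
      by (metis i(2) le_imp_less_Suc nth_eq_iff_index_eq)
    then have "y ! s = y ! t" using eq by simp
    then show False using rooted_perm_nth_inj[OF y(1)] s t q by auto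
  qed
  show False
  proof (cases "col (v ! i) = col (w ! i)")
    case True
    show False
    proof (cases "below (col (v ! i)) (v ! i) (w ! i)")
      case True
      then show False
        using same_kind[OF pv(1) pw i(3) True m] cell by blast
    next
      case False
      then have "below (col (w ! i)) (w ! i) (v ! i)"
        using below_linear[OF i(4), of "col (v ! i)"] True by simp
      then show False
        using same_kind[OF pw(1) pv _ _ j] cell i(3) by simp
    qed
  next
    case False
    obtain p where p: "i = Suc p" using i(1) by (cases i) auto
    have "v ! p = w ! p" "Suc p < length v" "Suc p < length w"
      using i p pv(1) pw(1) by (simp_all add: rooted_perm_def)
    then have "below (col (v ! i)) (v ! p) (v ! i)" "below (col (w ! i)) (v ! p) (w ! i)"
      using pv(2) pw(2) p unfolding zigzag_def by metis+
    then have "below (col (v ! i)) (w ! i) (v ! i)"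
      using False by (auto simp: below_def split: if_splits)
    moreover have "before w (w ! i) (v ! i)"
      using before_nthI[OF m(1), of w] m pw i by (simp add: rooted_perm_def)
    ultimately have "before v (w ! i) (v ! i)"
      using cell[of "v ! i" "w ! i"] False rooted_perm_nth_le[OF pv(1) i(2)]
        rooted_perm_nth_le[OF pw(1) i(2)] by simp
    moreover have "before v (v ! i) (w ! i)"
      using before_nthI[OF j(1), of v] j pv by (simp add: rooted_perm_def)
    ultimately show False 
      using before_asym[of v "v ! i" "w ! i"] pv(1) by (simp add: rooted_perm_def)
  qed
qed

section \<open>Nested trees and their traversals\<close>

text \<open>
  The trees behind tree-tableaux, given by their parent function on \<open>{1..n}\<close> (the root is
  \<open>0\<close>). A line lies strictly between its parent and its grandparent, if there is one. No cycles have to be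
  excluded separately, since the interval between a line and its parent grows strictly on the way
  up.
\<close>

definition nested :: "(nat \<Rightarrow> nat) \<Rightarrow> bool" where
  "nested par \<longleftrightarrow> (\<forall>x. 0 < x \<and> x \<le> n \<longrightarrow> par x \<le> n \<and> col (par x) \<noteq> col x \<and>
     below (col x) (par x) x \<and> (par x \<noteq> 0 \<longrightarrow> below (col x) x (par (par x))))"

text \<open>
  The trace that a depth-first search leaves in the word: what is written after the parent of
  \<open>v ! i\<close> and before \<open>v ! i\<close> are the subtrees of earlier siblings, and these stay
  between the two.
\<close>

definition traversed_at :: "(nat \<Rightarrow> nat) \<Rightarrow> nat list \<Rightarrow> nat \<Rightarrow> nat \<Rightarrow> bool" where
  "traversed_at par v i j \<longleftrightarrow> j < i \<and> v ! j = par (v ! i) \<and>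
     (\<forall>l. j < l \<and> l < i \<longrightarrow> below (col (v ! i)) (v ! j) (v ! l) \<and> below (col (v ! i)) (v ! l) (v ! i))"

definition traverses :: "(nat \<Rightarrow> nat) \<Rightarrow> nat list \<Rightarrow> bool" where
  "traverses par v \<longleftrightarrow> (\<forall>i. 0 < i \<and> i < length v \<longrightarrow> (\<exists>j. traversed_at par v i j))"

lemma nestedD:
  assumes "nested par" "0 < x" "x \<le> n"
  shows "par x \<le> n" "col (par x) \<longleftrightarrow> \<not> col x" "below (col x) (par x) x"
    "par x \<noteq> 0 \<Longrightarrow> below (col x) x (par (par x))"
  using assms unfolding nested_def by blast+

lemma traversed_atD:
  assumes "traversed_at par v i j"
  shows "j < i" "v ! j = par (v ! i)"
    "j < l \<Longrightarrow> l < i \<Longrightarrow> below (col (v ! i)) (v ! j) (v ! l)"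
    "j < l \<Longrightarrow> l < i \<Longrightarrow> below (col (v ! i)) (v ! l) (v ! i)"
  using assms unfolding traversed_at_def by blast+

lemma traversesE:
  assumes "traverses par v" "rooted_perm v" "0 < i" "i \<le> n"
  obtains j where "traversed_at par v i j"
proof -
  have "i < length v" using assms by (simp add: rooted_perm_def)
  then show thesis using assms that unfolding traverses_def by blast
qed

lemma traverses_zigzag:
  assumes "nested par" "rooted_perm v" "traverses par v"
  shows "zigzag v"
  unfolding zigzag_def
proof (intro allI impI)
  fix i assume i: "Suc i < length v"
  then have x: "0 < v ! Suc i" "v ! Suc i \<le> n"
    using assms(2) rooted_perm_nth_pos rooted_perm_nth_le
    by (simp_all add: rooted_perm_def less_Suc_eq_le)
  obtain j where j: "traversed_at par v (Suc i) j" using assms(3) i by (auto simp: traverses_def)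
  show "below (col (v ! Suc i)) (v ! i) (v ! Suc i)"
  proof (cases "j = i")
    case True
    then show ?thesis using j nestedD(3)[OF assms(1) x] by (simp add: traversed_at_def)
  next
    case False
    then show ?thesis using j by (simp add: traversed_at_def)
  qed
qed

text \<open>
  At the first place where two traversals of the same tree differ, the parents of the two competing
  letters lie in the common prefix. Each word therefore has one of the letters in the gap between
  the other letter and its parent, and the resulting inequalities contradict each other, whichever
  of the two parents comes first.
\<close>

lemma traversal_unique:
  assumes par: "nested par" and pv: "rooted_perm v" "traverses par v"
    and pw: "rooted_perm w" "traverses par w"
  shows "v = w"
proof (rule ccontr)
  assume "v \<noteq> w"
  obtain i j m where i: "0 < i" "i \<le> n" "\<forall>l<i. v ! l = w ! l" "v ! i \<noteq> w ! i"
    and j: "i < j" "j \<le> n" "v ! j = w ! i" and m: "i < m" "m \<le> n" "w ! m = v ! i"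
    by (rule first_difference[OF pv(1) pw(1) \<open>v \<noteq> w\<close>])
  have mj: "0 < m" "0 < j" using i m j by auto
  obtain a where a: "traversed_at par v i a" by (rule traversesE[OF pv(2,1) i(1,2)])
  obtain b where b: "traversed_at par w i b" by (rule traversesE[OF pw(2,1) i(1,2)])
  obtain a' where a': "traversed_at par w m a'" by (rule traversesE[OF pw(2,1) mj(1) m(2)])
  obtain b' where b': "traversed_at par v j b'" by (rule traversesE[OF pv(2,1) mj(2) j(2)])
  \<comment> \<open>Both parents lie in the common prefix.\<close>
  have ai: "a < i" "b < i" using a b by (auto simp: traversed_at_def)
  have prefix: "v ! a = w ! a" "v ! b = w ! b" using ai i(3) by blast+
  have "w ! a' = w ! a" "a' \<le> n"
    using a a' m prefix by (simp_all add: traversed_at_def)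
  then have [simp]: "a' = a" using rooted_perm_nth_inj[OF pw(1), of a' a] ai i by simp
  have "v ! b' = v ! b" "b' \<le> n"
    using b b' j prefix by (simp_all add: traversed_at_def)
  then have [simp]: "b' = b" using rooted_perm_nth_inj[OF pv(1), of b' b] ai i by simp
  have 1: "below (col (v ! i)) (v ! a) (w ! i)" "below (col (v ! i)) (w ! i) (v ! i)"
    using traversed_atD(3,4)[OF a', of i] m ai prefix by simp_all
  have 2: "below (col (w ! i)) (v ! b) (v ! i)" "below (col (w ! i)) (v ! i) (w ! i)"
    using traversed_atD(3,4)[OF b', of i] j ai by simp_all
  have 3: "a < b \<Longrightarrow> below (col (v ! i)) (v ! b) (v ! i)"
    using traversed_atD(4)[OF a] ai by simp
  have 4: "b < a \<Longrightarrow> below (col (w ! i)) (v ! a) (w ! i)"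
    using traversed_atD(4)[OF b, of a] ai prefix by simp
  have "a = b \<or> a < b \<or> b < a" by auto
  then show False using 1 2 3 4 by (auto simp: below_def split: if_splits)
qed

text \<open>
  Suppose that two trees with the same word place the parent of \<open>x\<close> at \<open>j\<close> and at
  a later \<open>j'\<close>. In the second tree the parent of the letter at \<open>j'\<close> lies beyond
  \<open>x\<close>. It cannot be written at \<open>j\<close> or later, where the first tree only allows letters on
  the near side of \<open>x\<close>, nor before \<open>j\<close>, because then the letter at \<open>j\<close>
  would be on the wrong side of the letter at \<open>j'\<close>.
\<close>

lemma parent_unique_aux:
  assumes "rooted_perm v" "nested par'" "traverses par' v"
    and i: "0 < i" "i \<le> n" and j: "traversed_at par v i j" and j': "traversed_at par' v i j'"
    and less: "j < j'"
  shows False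
proof -
  let ?x = "v ! i" and ?k = "col (v ! i)"
  have x: "0 < ?x" "?x \<le> n" using assms(1) i rooted_perm_nth_pos rooted_perm_nth_le by auto
  have j'i: "j' < i" using j' by (simp add: traversed_at_def)
  have between: "below ?k (v ! j) (v ! l)" "below ?k (v ! l) ?x" if "j < l" "l < i" for l
    using traversed_atD(3,4)[OF j that] .
  have y: "0 < v ! j'" using assms(1) less j'i i by (intro rooted_perm_nth_pos) auto
  have yx: "v ! j' = par' ?x" using j' by (simp add: traversed_at_def)
  have kind: "col (v ! j') \<longleftrightarrow> \<not> ?k" using nestedD(2)[OF assms(2) x] yx by simp
  have beyond: "below ?k ?x (par' (v ! j'))" using nestedD(4)[OF assms(2) x] yx y by simp
  obtain l where l: "traversed_at par' v j' l"
    using traversesE[OF assms(3,1), of j'] j'i less i by auto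
  have lj': "l < j'" and vl: "below ?k ?x (v ! l)" using traversed_atD(1,2)[OF l] beyond by simp_all
  have "\<not> j < l" using between(2)[of l] lj' j'i below_asym[OF vl] by auto
  moreover have "l \<noteq> j" using between[OF less j'i] below_asym[OF vl] below_trans by blast
  ultimately have "l < j" by auto
  then have "below (\<not> ?k) (v ! j) (v ! j')" using traversed_atD(4)[OF l _ less] kind by simp
  then show False using below_asym[OF between(1)[OF less j'i]] by (simp add: below_flip)
qed

lemma parent_unique:
  assumes v: "rooted_perm v" and par: "nested par" "traverses par v"
    and par': "nested par'" "traverses par' v" and x: "0 < x" "x \<le> n"
  shows "par x = par' x"
proof -
  obtain i where i: "i \<le> n" "v ! i = x" using rooted_perm_index[OF v x(2)] .
  have "0 < i" using i x v by (cases i) (auto simp: rooted_perm_def)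
  obtain j where j: "traversed_at par v i j" by (rule traversesE[OF par(2) v \<open>0 < i\<close> i(1)])
  obtain j' where j': "traversed_at par' v i j'" by (rule traversesE[OF par'(2) v \<open>0 < i\<close> i(1)])
  have "\<not> j < j'" "\<not> j' < j"
    using parent_unique_aux[OF v par' \<open>0 < i\<close> i(1) j j']
      parent_unique_aux[OF v par \<open>0 < i\<close> i(1) j' j] by auto
  then show ?thesis using j j' i by (auto simp: traversed_at_def)
qed

text \<open>
  Position \<open>j\<close> holds the extreme letter of the maximal run of letters below
  \<open>v ! i\<close> that ends at \<open>i - 1\<close>. The last clause expresses the maximality of the run:
  either the run reaches back to the start of the word, where the extreme letter is \<open>0\<close>, or
  before \<open>j\<close> there is a letter beyond \<open>v ! i\<close>, and up to it no letter is more extreme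
  than \<open>v ! j\<close>.
\<close>

definition parent_at :: "nat list \<Rightarrow> nat \<Rightarrow> nat \<Rightarrow> bool" where
  "parent_at v i j \<longleftrightarrow> j < i \<and> below (col (v ! i)) (v ! j) (v ! i) \<and>
     (\<forall>l. j < l \<and> l < i \<longrightarrow> below (col (v ! i)) (v ! j) (v ! l) \<and> below (col (v ! i)) (v ! l) (v ! i)) \<and>
     (j = 0 \<or> (\<exists>l<j. below (col (v ! i)) (v ! i) (v ! l) \<and>
        (\<forall>m. l < m \<and> m < j \<longrightarrow> below (col (v ! i)) (v ! j) (v ! m))))"

lemma parent_at_exists:
  assumes "v \<in> border_words" and i: "0 < i" "i \<le> n"
  shows "\<exists>j. parent_at v i j"
proof -
  have v: "rooted_perm v" "zigzag v" using assms by (auto simp: border_words_def)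
  let ?k = "col (v ! i)"
  let ?P = "\<lambda>s. s < i \<and> (\<forall>l. s \<le> l \<and> l < i \<longrightarrow> below ?k (v ! l) (v ! i))"
  obtain p where p: "i = Suc p" using i by (cases i) auto
  have "below ?k (v ! p) (v ! i)" using v i p by (auto simp: zigzag_def rooted_perm_def)
  then have "?P p" using p by (auto simp: less_Suc_eq_le dest: le_antisym)
  then obtain s where s: "?P s" "\<forall>t<s. \<not> ?P t" using exists_least_iff[of ?P] by blast
  obtain y where y: "y \<in> (!) v ` {s..<i}"
    "\<And>z. z \<in> (!) v ` {s..<i} \<Longrightarrow> z \<noteq> y \<Longrightarrow> below ?k y z"
    by (rule below_least[of "(!) v ` {s..<i}" ?k]) (use s in auto)
  then obtain j where j: "s \<le> j" "j < i" "y = v ! j" by auto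
  have least: "below ?k (v ! j) (v ! l)" if "s \<le> l" "l < i" "l \<noteq> j" for l
    using y(2)[of "v ! l"] that j i rooted_perm_nth_inj[OF v(1), of l j] by auto
  have "parent_at v i j"
  proof (cases "s = 0")
    case True
    have "v ! 0 = 0" using v by (simp add: rooted_perm_def)
    then have "?k" using s(1) True i by (auto simp: below_def split: if_splits)
    then have "j = 0" using least[of 0] True i \<open>v ! 0 = 0\<close> by (auto simp: below_def)
    then show ?thesis using s j least True unfolding parent_at_def by auto
  next
    case False
    then obtain t where t: "s = Suc t" by (cases s) auto
    have "\<not> below ?k (v ! t) (v ! i)"
    proof
      assume "below ?k (v ! t) (v ! i)"
      then have "?P t" using s(1) t by (metis Suc_leI Suc_lessD le_neq_implies_less)
      then show False using s(2) t by auto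
    qed
    moreover have "v ! t \<noteq> v ! i" using rooted_perm_nth_inj[OF v(1), of t i] s(1) t i by auto
    ultimately have "below ?k (v ! i) (v ! t)" using below_linear by blast
    then show ?thesis using s j least t unfolding parent_at_def by (auto intro!: exI[of _ t])
  qed
  then show ?thesis ..
qed

text \<open>
  The extreme letter of a run is entered from its far side: from inside the run because it is
  extreme, from outside because the run is maximal. At position \<open>0\<close> the letter is the top
  row.
\<close>

lemma parent_at_kind:
  assumes "v \<in> border_words" and i: "0 < i" "i \<le> n" and j: "parent_at v i j"
  shows "col (v ! j) \<longleftrightarrow> \<not> col (v ! i)"
proof -
  have v: "rooted_perm v" "zigzag v" using assms by (auto simp: border_words_def)
  let ?k = "col (v ! i)"
  show ?thesis
  proof (cases "j = 0")
    case True
    have "v ! 0 = 0" using v by (simp add: rooted_perm_def)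
    then have "?k" using j True by (auto simp: below_def parent_at_def split: if_splits)
    then show ?thesis using True \<open>v ! 0 = 0\<close> not_col_0 by simp
  next
    case False
    then obtain l where l: "l < j" "below ?k (v ! i) (v ! l)"
      "\<And>m. l < m \<Longrightarrow> m < j \<Longrightarrow> below ?k (v ! j) (v ! m)"
      using j unfolding parent_at_def by blast
    obtain p where p: "j = Suc p" using l by (cases j) auto
    have "below ?k (v ! j) (v ! p)"
    proof (cases "l = p")
      case True
      then show ?thesis using l(2) j below_trans unfolding parent_at_def by blast
    next
      case False
      then show ?thesis using l(1,3) p by auto
    qed
    moreover have "below (col (v ! j)) (v ! p) (v ! j)"
      using v p j i by (auto simp: zigzag_def parent_at_def rooted_perm_def)
    ultimately show ?thesis by (rule below_opposite)
  qed
qed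

text \<open>
  This is the nesting condition. The run that determines the parent of \<open>v ! j\<close> extends at
  least to the letter beyond \<open>v ! i\<close> that bounds the run of \<open>v ! i\<close>, so its extreme
  letter is at least as far.
\<close>

lemma parent_at_beyond:
  assumes "v \<in> border_words" and i: "0 < i" "i \<le> n"
    and j: "parent_at v i j" "0 < j" and j2: "parent_at v j j2"
  shows "below (col (v ! i)) (v ! i) (v ! j2)"
proof -
  let ?k = "col (v ! i)"
  have kind: "col (v ! j) \<longleftrightarrow> \<not> ?k" using parent_at_kind assms by blast
  have vji: "below ?k (v ! j) (v ! i)" using j by (simp add: parent_at_def)
  obtain l where l: "l < j" "below ?k (v ! i) (v ! l)"
    "\<And>m. l < m \<Longrightarrow> m < j \<Longrightarrow> below ?k (v ! j) (v ! m)"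
    using j unfolding parent_at_def by blast
  consider "j2 < l" | "j2 = l" | "l < j2" by linarith
  then show ?thesis
  proof cases
    case 1
    then have "below (\<not> ?k) (v ! j2) (v ! l)" using j2 l kind by (simp add: parent_at_def)
    then show ?thesis using below_trans[OF l(2)] by (simp add: below_flip)
  next
    case 2
    then show ?thesis using l by simp
  next
    case 3
    then obtain l2 where l2: "l2 < j2" "below (\<not> ?k) (v ! j) (v ! l2)"
      "\<And>m. l2 < m \<Longrightarrow> m < j2 \<Longrightarrow> below (\<not> ?k) (v ! j2) (v ! m)"
      using j2 kind 3 unfolding parent_at_def by auto
    have "j2 < j" using j2 by (simp add: parent_at_def)
    have "\<not> below ?k (v ! j) (v ! l2)" using below_asym l2(2) by (simp add: below_flip)
    then have "\<not> l < l2" using l(3)[of l2] l2(1) \<open>j2 < j\<close> by linarith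
    moreover have "l2 \<noteq> l" using l2(2) l(2) vji by (auto simp: below_def split: if_splits)
    ultimately have "below (\<not> ?k) (v ! j2) (v ! l)" using l2(3)[of l] 3 by linarith
    then show ?thesis using below_trans[OF l(2)] by (simp add: below_flip)
  qed
qed

lemma border_word_traverses:
  assumes "v \<in> border_words"
  obtains par where "nested par" "traverses par v"
proof -
  have v: "rooted_perm v" "zigzag v" using assms by (auto simp: border_words_def)
  define pos where "pos x = (THE i. i \<le> n \<and> v ! i = x)" for x
  have pos: "pos (v ! i) = i" if "i \<le> n" for i
    unfolding pos_def using rooted_perm_nth_inj[OF v(1)] that by auto
  define par where "par x = v ! (SOME j. parent_at v (pos x) j)" for x
  have par: "\<exists>j. parent_at v i j \<and> par (v ! i) = v ! j" if "0 < i" "i \<le> n" for i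
    unfolding par_def pos[OF that(2)] using parent_at_exists[OF assms that] by (metis someI_ex)
  have "nested par"
    unfolding nested_def
  proof (intro allI impI)
    fix x assume x: "0 < x \<and> x \<le> n"
    then obtain i where i: "i \<le> n" "v ! i = x" using rooted_perm_index[OF v(1)] by metis
    have i0: "0 < i" using x i v by (cases i) (auto simp: rooted_perm_def)
    obtain j where j: "parent_at v i j" "par x = v ! j" using par[OF i0 i(1)] i by auto
    have ji: "j < i" "below (col x) (v ! j) x" using j i by (auto simp: parent_at_def)
    have "below (col x) x (par (v ! j))" if "v ! j \<noteq> 0"
    proof -
      have j0: "0 < j" using that v by (cases j) (auto simp: rooted_perm_def)
      then obtain j2 where "parent_at v j j2" "par (v ! j) = v ! j2" using par[of j] ji i by auto
      then show ?thesis using parent_at_beyond[OF assms i0 i(1) j(1) j0] i by auto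
    qed
    then show "par x \<le> n \<and> col (par x) \<noteq> col x \<and> below (col x) (par x) x \<and>
        (par x \<noteq> 0 \<longrightarrow> below (col x) x (par (par x)))"
      using parent_at_kind[OF assms i0 i(1) j(1)] rooted_perm_nth_le[OF v(1), of j] j ji i by auto
  qed
  moreover have "traverses par v"
    unfolding traverses_def
  proof (intro allI impI)
    fix i assume "0 < i \<and> i < length v"
    then obtain j where "parent_at v i j" "par (v ! i) = v ! j"
      using par[of i] v by (auto simp: rooted_perm_def)
    then show "\<exists>j. traversed_at par v i j"
      by (intro exI[of _ j]) (simp add: traversed_at_def parent_at_def)
  qed
  ultimately show thesis using that by blast
qed

section \<open>Depth-first search in a nested tree\<close>

definition open_children :: "(nat \<Rightarrow> nat) \<Rightarrow> nat list \<Rightarrow> nat \<Rightarrow> nat set" where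
  "open_children par vs x = {y. 0 < y \<and> y \<le> n \<and> par y = x \<and> y \<notin> set vs}"

text \<open>
  The invariant of the search. A line \<open>vs ! l\<close> that was visited after \<open>vs ! j\<close>
  but hangs off an earlier line shows that the search has backtracked past \<open>vs ! j\<close>, whose
  children must then be exhausted. The last condition expresses that children are visited in the
  order of their distance from the parent.
\<close>

definition depth_first :: "(nat \<Rightarrow> nat) \<Rightarrow> nat list \<Rightarrow> bool" where
  "depth_first par vs \<longleftrightarrow> vs \<noteq> [] \<and> distinct vs \<and> set vs \<subseteq> {..n} \<and> vs ! 0 = 0 \<and> traverses par vs \<and>
     (\<forall>l j m. m < j \<and> j < l \<and> l < length vs \<and> vs ! m = par (vs ! l) \<longrightarrow>
        open_children par vs (vs ! j) = {}) \<and>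
     (\<forall>x y. 0 < x \<and> x \<le> n \<and> x \<notin> set vs \<and> 0 < y \<and> y \<in> set vs \<and> par y = par x \<longrightarrow>
        below (col x) y x)"

lemma depth_firstD:
  assumes "depth_first par vs"
  shows "vs \<noteq> []" "distinct vs" "set vs \<subseteq> {..n}" "vs ! 0 = 0"
    "\<And>l. 0 < l \<Longrightarrow> l < length vs \<Longrightarrow> \<exists>m. traversed_at par vs l m"
    "\<And>l j m. m < j \<Longrightarrow> j < l \<Longrightarrow> l < length vs \<Longrightarrow> vs ! m = par (vs ! l) \<Longrightarrow>
        open_children par vs (vs ! j) = {}"
    "\<And>x y. 0 < x \<Longrightarrow> x \<le> n \<Longrightarrow> x \<notin> set vs \<Longrightarrow> 0 < y \<Longrightarrow> y \<in> set vs \<Longrightarrow> par y = par x \<Longrightarrow>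
        below (col x) y x"
  using assms unfolding depth_first_def traverses_def by blast+

lemma depth_first_nth:
  assumes "depth_first par vs" "0 < l" "l < length vs"
  shows "0 < vs ! l" "vs ! l \<le> n"
proof -
  note d = depth_firstD[OF assms(1)]
  have "vs ! l \<noteq> vs ! 0" using d(1,2) assms by (simp add: nth_eq_iff_index_eq)
  then show "0 < vs ! l" using d(4) by simp
  show "vs ! l \<le> n" using d(3) nth_mem[OF assms(3)] by auto
qed

text \<open>
  Here \<open>vs ! j\<close> still has the unvisited child \<open>x\<close>, so nothing visited later can hang
  off an earlier line: it belongs to subtrees of children of \<open>vs ! j\<close>. Those children are
  nearer than \<open>x\<close>, and their descendants are squeezed between two lines for which the claim
  already holds.
\<close>

lemma depth_first_between:
  assumes par: "nested par" and d: "depth_first par vs"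
    and j: "j < length vs" "x \<in> open_children par vs (vs ! j)"
    and l: "j < l" "l < length vs"
  shows "below (col x) (vs ! j) (vs ! l) \<and> below (col x) (vs ! l) x"
  using l
proof (induction l rule: less_induct)
  case (less l)
  have x: "0 < x" "x \<le> n" "par x = vs ! j" "x \<notin> set vs" using j by (auto simp: open_children_def)
  have visited: "\<exists>m. traversed_at par vs i m \<and> j \<le> m" if i: "j < i" "i < length vs" for i
  proof -
    obtain m where m: "traversed_at par vs i m" using depth_firstD(5)[OF d, of i] i by auto
    have "\<not> m < j"
      using depth_firstD(6)[OF d, of m j i] i j traversed_atD(2)[OF m] by auto
    then show ?thesis using m by auto
  qed
  have pos: "0 < vs ! l" "vs ! l \<le> n" using depth_first_nth[OF d] less by auto
  obtain m where m: "traversed_at par vs l m" "j \<le> m" using visited less by blast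
  have par_l: "par (vs ! l) = vs ! m" "m < l" using traversed_atD(1,2)[OF m(1)] by auto
  show ?case
  proof (cases "m = j")
    case True
    then have same: "par (vs ! l) = par x" using par_l x by simp
    then have "col (vs ! l) = col x"
      using nestedD(2)[OF par pos] nestedD(2)[OF par x(1,2)] by simp
    then show ?thesis
      using depth_firstD(7)[OF d x(1,2,4) pos(1) _ same] nestedD(3)[OF par pos] less True par_l
      by simp
  next
    case False
    then have jm: "j < m" "m < length vs" using m par_l less by auto
    then have m0: "0 < vs ! m" "vs ! m \<le> n" using depth_first_nth[OF d] by auto
    obtain q where q: "traversed_at par vs m q" "j \<le> q" using visited jm by blast
    have par_m: "par (vs ! m) = vs ! q" "q < m" using traversed_atD(1,2)[OF q(1)] by auto
    have IHm: "below (col x) (vs ! j) (vs ! m)" "below (col x) (vs ! m) x"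
      using less.IH[of m] par_l jm by auto
    have IHq: "q = j \<or> below (col x) (vs ! j) (vs ! q) \<and> below (col x) (vs ! q) x"
      using less.IH[of q] par_l par_m q jm by auto
    have jx: "below (col x) (vs ! j) x" using nestedD(3)[OF par x(1,2)] x by simp
    have "below (col (vs ! l)) (vs ! m) (vs ! l)" "below (col (vs ! l)) (vs ! l) (vs ! q)"
      using nestedD(3,4)[OF par pos] par_l par_m m0 by auto
    then show ?thesis
      using IHm IHq jx by (cases "col x"; cases "col (vs ! l)") (auto simp: below_def)
  qed
qed

lemma depth_first_step:
  assumes par: "nested par" and d: "depth_first par vs"
    and j: "j < length vs" "x \<in> open_children par vs (vs ! j)"
    and last: "\<And>l. j < l \<Longrightarrow> l < length vs \<Longrightarrow> open_children par vs (vs ! l) = {}"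
    and nearest: "\<And>y. y \<in> open_children par vs (vs ! j) \<Longrightarrow> y \<noteq> x \<Longrightarrow> below (col x) x y"
  shows "depth_first par (vs @ [x])"
proof -
  let ?ws = "vs @ [x]"
  have x: "0 < x" "x \<le> n" "par x = vs ! j" "x \<notin> set vs" using j by (auto simp: open_children_def)
  note d' = depth_firstD[OF d]
  have shrink: "open_children par ?ws y \<subseteq> open_children par vs y" for y
    by (auto simp: open_children_def)
  have trav: "\<exists>m. traversed_at par ?ws i m" if i: "0 < i" "i < length ?ws" for i
  proof (cases "i < length vs")
    case True
    then obtain m where "traversed_at par vs i m" using d'(5) i by blast
    then have "traversed_at par ?ws i m"
      using True by (auto simp: traversed_at_def nth_append)
    then show ?thesis ..
  next
    case False
    then have "i = length vs" using i by simp
    then have "traversed_at par ?ws i j"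
      using depth_first_between[OF par d j] j x by (auto simp: traversed_at_def nth_append)
    then show ?thesis ..
  qed
  have closed: "open_children par ?ws (?ws ! i) = {}"
    if i: "m < i" "i < l" "l < length ?ws" "?ws ! m = par (?ws ! l)" for l i m
  proof (cases "l < length vs")
    case True
    then have "open_children par vs (vs ! i) = {}" using d'(6)[of m i l] i by (simp add: nth_append)
    then show ?thesis using shrink True i by (auto simp: nth_append)
  next
    case False
    then have "l = length vs" using i by simp
    then have "vs ! m = vs ! j" "i < length vs" using i x by (auto simp: nth_append)
    then have "m = j" using d'(2) i j by (simp add: nth_eq_iff_index_eq)
    then have "open_children par vs (vs ! i) = {}" using last i \<open>i < length vs\<close> by simp
    then show ?thesis using shrink \<open>i < length vs\<close> by (auto simp: nth_append)
  qed
  have sib: "below (col z) y z"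
    if "0 < z" "z \<le> n" "z \<notin> set ?ws" "0 < y" "y \<in> set ?ws" "par y = par z" for y z
  proof (cases "y = x")
    case True
    then have "z \<in> open_children par vs (vs ! j)" "z \<noteq> x" using that x by (auto simp: open_children_def)
    moreover have "col z = col x"
      using nestedD(2)[OF par that(1,2)] nestedD(2)[OF par x(1,2)] that True by simp
    ultimately show ?thesis using nearest[of z] True by simp
  next
    case False
    then show ?thesis using d'(7)[of z y] that by simp
  qed
  show ?thesis
    unfolding depth_first_def traverses_def
    using d'(1-4) x trav closed sib by (auto simp: nth_append)
qed

lemma depth_first_root: "depth_first par [0]"
  by (auto simp: depth_first_def traverses_def)

text \<open>
  Among the unvisited lines choose one at the largest distance from its parent. The parent, if it
  were unvisited, would be at a still larger distance from its own parent, by the nesting.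
\<close>

lemma depth_first_open:
  assumes par: "nested par" and d: "depth_first par vs" and len: "length vs \<le> n"
  shows "\<exists>j<length vs. open_children par vs (vs ! j) \<noteq> {}"
proof -
  note d' = depth_firstD[OF d]
  \<comment> \<open>The absolute difference in truncated subtraction.\<close>
  let ?gap = "\<lambda>x. (x - par x) + (par x - x)"
  let ?P = "\<lambda>x. x \<le> n \<and> x \<notin> set vs"
  have "card (set vs) < card {..n}" using d'(2) len distinct_card by fastforce
  then have "\<exists>x. ?P x"
    using card_mono[of "set vs" "{..n}"] by (metis List.finite_set atMost_iff leD subsetI)
  moreover have nonzero: "0 < x" if "?P x" for x
    using that d'(1,4) by (metis gr0I length_greater_0_conv nth_mem)
  have bound: "?gap x \<le> n" if "?P x" for x
    using nestedD(1)[OF par nonzero[OF that]] that by auto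
  ultimately obtain x where x: "?P x" "\<And>y. ?P y \<Longrightarrow> ?gap y \<le> ?gap x"
    using ex_has_greatest_nat[of ?P _ ?gap "Suc n"] by (meson le_imp_less_Suc less_imp_le_nat)
  have xn: "0 < x" "x \<le> n" using x nonzero by auto
  have "par x \<in> set vs"
  proof (rule ccontr)
    assume new: "par x \<notin> set vs"
    then have P: "?P (par x)" using nestedD(1)[OF par xn] by simp
    then have "0 < par x" by (rule nonzero)
    then have "below (col x) x (par (par x))" "below (col x) (par x) x"
      using nestedD(3,4)[OF par xn] by auto
    then show False using x(2)[OF P] by (auto simp: below_def split: if_splits)
  qed
  then obtain j where "j < length vs" "vs ! j = par x" by (auto simp: in_set_conv_nth)
  moreover from this have "x \<in> open_children par vs (vs ! j)"
    using x xn by (simp add: open_children_def)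
  ultimately show ?thesis by blast
qed

end

section \<open>The labels of a Ferrers diagram\<close>

lemma ferrersD:
  assumes "ferrers F"
  shows "0 < nrows F" "\<And>i j. i \<le> j \<Longrightarrow> j < nrows F \<Longrightarrow> F ! j \<le> F ! i" "\<And>i. i < nrows F \<Longrightarrow> 0 < F ! i"
proof -
  show "0 < nrows F" using assms by (simp add: ferrers_def nrows_def)
  show "F ! j \<le> F ! i" if "i \<le> j" "j < nrows F" for i j
    using assms that sorted_wrt_nth_less[of "(\<ge>)" F i j]
    by (cases "i = j") (auto simp: ferrers_def nrows_def)
  show "0 < F ! i" if "i < nrows F" for i
    using assms that by (auto simp: ferrers_def nrows_def)
qed

text \<open>
  The order in which lines appear on the border, read off from the shape: a line precedes another of
  the other kind according to whether the two meet in a cell.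
\<close>

fun line_less :: "nat list \<Rightarrow> line \<Rightarrow> line \<Rightarrow> bool" where
  "line_less F (Row r) (Row r') \<longleftrightarrow> r < r'"
| "line_less F (Row r) (Col c) \<longleftrightarrow> c < F ! r"
| "line_less F (Col c) (Row r) \<longleftrightarrow> F ! r \<le> c"
| "line_less F (Col c) (Col c') \<longleftrightarrow> c' < c"

lemma line_less_irrefl: "\<not> line_less F l l"
  by (cases l) auto

lemma line_less_asym: "line_less F l m \<Longrightarrow> \<not> line_less F m l"
  by (cases l; cases m) auto

text \<open>
  The piece of the border contributed by one row: its own vertical step followed by the columns that
  end in it.
\<close>

definition border_step :: "nat list \<Rightarrow> nat \<Rightarrow> line list" where
  "border_step F r = Row r # map Col (rev [(if Suc r < nrows F then F ! Suc r else 0) ..< F ! r])"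

lemma border_eq: "border F = concat (map (border_step F) [0..<nrows F])"
  by (simp add: border_def border_step_def[abs_def])

lemma set_border_step:
  "set (border_step F r) = insert (Row r) (Col ` {(if Suc r < nrows F then F ! Suc r else 0) ..< F ! r})"
  by (auto simp: border_step_def)

lemma sorted_border_step: "sorted_wrt (line_less F) (border_step F r)"
proof -
  have "sorted_wrt (line_less F) (map Col (rev [a..<b]))" for a b
    by (simp add: sorted_wrt_map sorted_wrt_rev)
  then show ?thesis by (auto simp: border_step_def)
qed

lemma sorted_border:
  assumes "ferrers F"
  shows "sorted_wrt (line_less F) (border F)"
proof -
  have "sorted_wrt (line_less F) (concat (map (border_step F) [0..<m]))" if "m \<le> nrows F" for m
    using that
  proof (induction m)
    case (Suc m)
    have "line_less F l l'" if r: "r < m" "l \<in> set (border_step F r)" and l': "l' \<in> set (border_step F m)"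
      for r l l'
    proof -
      have "F ! m \<le> F ! Suc r" "F ! Suc r \<le> F ! r" "Suc r < nrows F"
        using ferrersD(2)[OF assms, of "Suc r" m] ferrersD(2)[OF assms, of r "Suc r"] r Suc.prems
        by auto
      then show ?thesis using r l' by (auto simp: set_border_step)
    qed
    then show ?case using Suc sorted_border_step by (auto simp: sorted_wrt_append)
  qed simp
  then show ?thesis by (simp add: border_eq)
qed

lemma set_border:
  assumes "ferrers F"
  shows "set (border F) = Row ` {..<nrows F} \<union> Col ` {..<ncols F}"
proof
  show "set (border F) \<subseteq> Row ` {..<nrows F} \<union> Col ` {..<ncols F}"
  proof
    fix l assume "l \<in> set (border F)"
    then obtain r where r: "r < nrows F" "l \<in> set (border_step F r)" by (auto simp: border_eq)
    have "F ! r \<le> ncols F" using ferrersD(2)[OF assms, of 0 r] r by (simp add: ncols_def)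
    then show "l \<in> Row ` {..<nrows F} \<union> Col ` {..<ncols F}"
      using r by (auto simp: set_border_step)
  qed
  have "Col c \<in> set (border F)" if c: "c < ncols F" for c
  proof -
    let ?R = "{r. r < nrows F \<and> c < F ! r}"
    have "finite ?R" "0 \<in> ?R" using c ferrersD(1)[OF assms] by (auto simp: ncols_def)
    moreover from this have "Max ?R \<in> ?R" by (intro Max_in) auto
    moreover have "Suc (Max ?R) \<notin> ?R"
      using Max_ge[OF \<open>finite ?R\<close>, of "Suc (Max ?R)"] by linarith
    ultimately have max: "Max ?R < nrows F" "c < F ! Max ?R"
      "\<not> (Suc (Max ?R) < nrows F \<and> c < F ! Suc (Max ?R))" by blast+
    then have "Col c \<in> set (border_step F (Max ?R))" by (auto simp: set_border_step)
    then show ?thesis using max by (auto simp: border_eq)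
  qed
  moreover have "Row r \<in> set (border F)" if "r < nrows F" for r
    using that by (auto simp: border_eq border_step_def)
  ultimately show "Row ` {..<nrows F} \<union> Col ` {..<ncols F} \<subseteq> set (border F)" by auto
qed

lemma distinct_border:
  assumes "ferrers F"
  shows "distinct (border F)"
  using sorted_wrt_nth_less[OF sorted_border[OF assms]] line_less_irrefl
  by (metis distinct_conv_nth nat_neq_iff)

lemma length_border:
  assumes "ferrers F"
  shows "length (border F) = Suc (tab_size F)"
proof -
  have "length (border F) = card (set (border F))"
    using distinct_border[OF assms] by (simp add: distinct_card)
  also have "\<dots> = nrows F + ncols F"
    unfolding set_border[OF assms] by (subst card_Un_disjoint) (auto simp: card_image inj_on_def)
  finally show ?thesis using ferrersD(1)[OF assms] by (simp add: tab_size_def)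
qed

lemma label_border:
  assumes "ferrers F" "i \<le> tab_size F"
  shows "label F (border F ! i) = i"
  unfolding label_def using assms
  by (auto simp: length_border nth_eq_iff_index_eq distinct_border)

lemma label_of_line:
  assumes "ferrers F" "l \<in> set (border F)"
  shows "label F l \<le> tab_size F" "border F ! label F l = l"
proof -
  obtain i where "i \<le> tab_size F" "border F ! i = l"
    using assms by (auto simp: in_set_conv_nth length_border less_Suc_eq_le)
  then show "label F l \<le> tab_size F" "border F ! label F l = l" using label_border[OF assms(1)] by auto
qed

lemma border_less_iff:
  assumes "ferrers F" "i \<le> tab_size F" "j \<le> tab_size F"
  shows "line_less F (border F ! i) (border F ! j) \<longleftrightarrow> i < j"
proof -
  have *: "line_less F (border F ! i) (border F ! j)" if "i < j" "j \<le> tab_size F" for i j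
    using sorted_wrt_nth_less[OF sorted_border[OF assms(1)] that(1)] that length_border[OF assms(1)]
    by simp
  then show ?thesis using assms line_less_irrefl line_less_asym by (metis nat_neq_iff)
qed

definition is_col :: "nat list \<Rightarrow> nat \<Rightarrow> bool" where
  "is_col F a \<longleftrightarrow> (\<exists>c. border F ! a = Col c)"

fun line_index :: "line \<Rightarrow> nat" where
  "line_index (Row r) = r"
| "line_index (Col c) = c"

text \<open>
  The number of the line with a given label, in the numbering of rows or of columns.
\<close>

definition index :: "nat list \<Rightarrow> nat \<Rightarrow> nat" where
  "index F a = line_index (border F ! a)"

lemma border_nth: "border F ! a = (if is_col F a then Col (index F a) else Row (index F a))"
  by (cases "border F ! a") (auto simp: is_col_def index_def)

lemma row_label:
  assumes "ferrers F" "r < nrows F"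
  shows "label F (Row r) \<le> tab_size F" "\<not> is_col F (label F (Row r))" "index F (label F (Row r)) = r"
  using label_of_line[OF assms(1), of "Row r"] assms by (auto simp: set_border is_col_def index_def)

lemma col_label:
  assumes "ferrers F" "c < ncols F"
  shows "label F (Col c) \<le> tab_size F" "is_col F (label F (Col c))" "index F (label F (Col c)) = c"
  using label_of_line[OF assms(1), of "Col c"] assms by (auto simp: set_border is_col_def index_def)

lemma label_index:
  assumes "ferrers F" "a \<le> tab_size F"
  shows "\<not> is_col F a \<Longrightarrow> label F (Row (index F a)) = a" "is_col F a \<Longrightarrow> label F (Col (index F a)) = a"
  using label_border[OF assms] border_nth[of F a] by auto

lemma index_less:
  assumes "ferrers F" "a \<le> tab_size F"
  shows "\<not> is_col F a \<Longrightarrow> index F a < nrows F" "is_col F a \<Longrightarrow> index F a < ncols F"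
proof -
  have "border F ! a \<in> set (border F)" using assms by (simp add: length_border less_Suc_eq_le)
  then show "\<not> is_col F a \<Longrightarrow> index F a < nrows F" "is_col F a \<Longrightarrow> index F a < ncols F"
    unfolding border_nth[of F a] set_border[OF assms(1)] by (auto split: if_splits)
qed

lemma row_index_less_iff:
  assumes "ferrers F" "a \<le> tab_size F" "b \<le> tab_size F" "\<not> is_col F a" "\<not> is_col F b"
  shows "index F a < index F b \<longleftrightarrow> a < b"
  using border_less_iff[OF assms(1-3)] border_nth[of F a] border_nth[of F b] assms by simp

lemma col_index_less_iff:
  assumes "ferrers F" "a \<le> tab_size F" "b \<le> tab_size F" "is_col F a" "is_col F b"
  shows "index F a < index F b \<longleftrightarrow> b < a"
  using border_less_iff[OF assms(1,3,2)] border_nth[of F a] border_nth[of F b] assms by simp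

lemma index_cell_iff:
  assumes "ferrers F" "a \<le> tab_size F" "b \<le> tab_size F" "\<not> is_col F a" "is_col F b"
  shows "(index F a, index F b) \<in> cells F \<longleftrightarrow> a < b"
  using border_less_iff[OF assms(1-3)] border_nth[of F a] border_nth[of F b] assms
    index_less[OF assms(1)]
  by (simp add: cells_def)

lemma cellD:
  assumes "ferrers F" "(r, c) \<in> cells F"
  shows "r < nrows F" "c < ncols F" "label F (Row r) < label F (Col c)"
proof -
  show r: "r < nrows F" using assms by (simp add: cells_def)
  have "F ! r \<le> F ! 0" using ferrersD(2)[OF assms(1), of 0 r] r by simp
  then show c: "c < ncols F" using assms by (simp add: cells_def ncols_def)
  show "label F (Row r) < label F (Col c)"
    using index_cell_iff[OF assms(1) row_label(1)[OF assms(1) r] col_label(1)[OF assms(1) c]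
        row_label(2)[OF assms(1) r] col_label(2)[OF assms(1) c]]
      row_label(3)[OF assms(1) r] col_label(3)[OF assms(1) c] assms(2) by simp
qed

lemma label_row_less_iff:
  assumes "ferrers F" "r < nrows F" "r' < nrows F"
  shows "label F (Row r) < label F (Row r') \<longleftrightarrow> r < r'"
  using row_index_less_iff[OF assms(1) row_label(1)[OF assms(1,2)] row_label(1)[OF assms(1,3)]
      row_label(2)[OF assms(1,2)] row_label(2)[OF assms(1,3)]]
    row_label(3)[OF assms(1,2)] row_label(3)[OF assms(1,3)] by simp

lemma label_col_less_iff:
  assumes "ferrers F" "c < ncols F" "c' < ncols F"
  shows "label F (Col c) < label F (Col c') \<longleftrightarrow> c' < c"
  using col_index_less_iff[OF assms(1) col_label(1)[OF assms(1,3)] col_label(1)[OF assms(1,2)]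
      col_label(2)[OF assms(1,3)] col_label(2)[OF assms(1,2)]]
    col_label(3)[OF assms(1,2)] col_label(3)[OF assms(1,3)] by simp

lemma ncols_pos: "ferrers F \<Longrightarrow> 0 < ncols F"
  using ferrersD(1,3) by (auto simp: ncols_def)

lemma label_top_row:
  assumes "ferrers F"
  shows "label F (Row 0) = 0" "border F ! 0 = Row 0"
proof -
  have "0 \<le> tab_size F" "Row 0 \<in> set (border F)"
    using ferrersD(1)[OF assms] by (auto simp: set_border[OF assms])
  have "\<not> line_less F (border F ! 0) (Row 0)"
  proof (cases "border F ! 0")
    case (Col c)
    have "border F ! 0 \<in> set (border F)" using assms by (simp add: length_border)
    then show ?thesis using Col by (auto simp: set_border[OF assms] ncols_def)
  qed simp
  then show *: "label F (Row 0) = 0"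
    using border_less_iff[OF assms, of 0 "label F (Row 0)"] label_of_line[OF assms \<open>Row 0 \<in> _\<close>] by simp
  then show "border F ! 0 = Row 0" using label_of_line[OF assms \<open>Row 0 \<in> _\<close>] by simp
qed

lemma label_first_col:
  assumes "ferrers F"
  shows "label F (Col 0) = tab_size F" "border F ! tab_size F = Col 0"
proof -
  have c: "Col 0 \<in> set (border F)" using ncols_pos[OF assms] by (auto simp: set_border[OF assms])
  have "\<not> line_less F (Col 0) (border F ! tab_size F)"
  proof (cases "border F ! tab_size F")
    case (Row r)
    have "border F ! tab_size F \<in> set (border F)" using assms by (simp add: length_border)
    then show ?thesis using Row ferrersD(3)[OF assms] by (auto simp: set_border[OF assms])
  qed simp
  then show *: "label F (Col 0) = tab_size F"
    using border_less_iff[OF assms, of "label F (Col 0)" "tab_size F"] label_of_line[OF assms c] by simp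
  then show "border F ! tab_size F = Col 0" using label_of_line[OF assms c] by simp
qed

lemma border_steps_ferrers:
  assumes "ferrers F"
  shows "border_steps (tab_size F) (is_col F)"
  using label_top_row[OF assms] label_first_col[OF assms]
  by unfold_locales (simp_all add: is_col_def)

lemma index_top: "ferrers F \<Longrightarrow> index F 0 = 0" "ferrers F \<Longrightarrow> index F (tab_size F) = 0"
  using label_top_row(2) label_first_col(2) by (simp_all add: index_def)

text \<open>
  The labels of the rows, in increasing order, give the labels of row \<open>0\<close>, row \<open>1\<close>
  and so on, and the length of a row is the number of columns with a larger label.
\<close>

lemma ferrers_eqI:
  assumes F: "ferrers F" and G: "ferrers G" and size: "tab_size F = tab_size G"
    and cols: "\<And>a. a \<le> tab_size F \<Longrightarrow> is_col F a \<longleftrightarrow> is_col G a"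
  shows "F = G"
proof -
  let ?n = "tab_size F"
  have rows: "map (\<lambda>r. label H (Row r)) [0..<nrows H] = sorted_list_of_set {a. a \<le> tab_size H \<and> \<not> is_col H a}"
    if H: "ferrers H" for H
  proof (rule sorted_list_of_set.idem_if_sorted_distinct[symmetric, THEN trans])
    show "sorted (map (\<lambda>r. label H (Row r)) [0..<nrows H])"
      using label_row_less_iff[OF H]
      by (auto simp: sorted_iff_nth_mono_less less_imp_le)
    show "distinct (map (\<lambda>r. label H (Row r)) [0..<nrows H])"
      unfolding distinct_map
      using inj_on_inverseI[of "{0..<nrows H}" "index H" "\<lambda>r. label H (Row r)"] row_label(3)[OF H]
      by simp
    have "set (map (\<lambda>r. label H (Row r)) [0..<nrows H]) = {a. a \<le> tab_size H \<and> \<not> is_col H a}"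
      using row_label[OF H] label_index(1)[OF H] index_less(1)[OF H]
      by (auto simp: image_iff) (metis atLeastLessThan_iff zero_le)
    then show "sorted_list_of_set (set (map (\<lambda>r. label H (Row r)) [0..<nrows H])) =
        sorted_list_of_set {a. a \<le> tab_size H \<and> \<not> is_col H a}" by simp
  qed
  have "{a. a \<le> tab_size F \<and> \<not> is_col F a} = {a. a \<le> tab_size G \<and> \<not> is_col G a}"
    using cols size by auto
  then have eq: "map (\<lambda>r. label F (Row r)) [0..<nrows F] = map (\<lambda>r. label G (Row r)) [0..<nrows G]"
    using rows[OF F] rows[OF G] by simp
  have len: "nrows F = nrows G" using arg_cong[OF eq, of length] by simp
  have lab: "label F (Row r) = label G (Row r)" if "r < nrows F" for r
    using arg_cong[OF eq, of "\<lambda>xs. xs ! r"] that len by simp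
  have width: "H ! r = card {b. b \<le> tab_size H \<and> is_col H b \<and> label H (Row r) < b}"
    if H: "ferrers H" and r: "r < nrows H" for H r
  proof -
    have "bij_betw (\<lambda>c. label H (Col c)) {..<H ! r} {b. b \<le> tab_size H \<and> is_col H b \<and> label H (Row r) < b}"
    proof (rule bij_betw_byWitness[where f' = "index H"])
      have c: "c < ncols H" "label H (Row r) < label H (Col c)" if "c < H ! r" for c
        using cellD[OF H, of r c] that r by (auto simp: cells_def)
      show "\<forall>c\<in>{..<H ! r}. index H (label H (Col c)) = c" using c col_label[OF H] by auto
      show "\<forall>b\<in>{b. b \<le> tab_size H \<and> is_col H b \<and> label H (Row r) < b}. label H (Col (index H b)) = b"
        using label_index[OF H] by auto
      show "(\<lambda>c. label H (Col c)) ` {..<H ! r} \<subseteq> {b. b \<le> tab_size H \<and> is_col H b \<and> label H (Row r) < b}"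
        using c col_label[OF H] by auto
      show "index H ` {b. b \<le> tab_size H \<and> is_col H b \<and> label H (Row r) < b} \<subseteq> {..<H ! r}"
        using index_cell_iff[OF H row_label(1)[OF H r] _ row_label(2)[OF H r]] row_label(3)[OF H r]
        by (auto simp: cells_def)
    qed
    then show ?thesis using bij_betw_same_card by fastforce
  qed
  show "F = G"
  proof (rule nth_equalityI)
    show "length F = length G" using len by (simp add: nrows_def)
    fix r assume "r < length F"
    then have r: "r < nrows F" "r < nrows G" using len by (auto simp: nrows_def)
    have "{b. b \<le> tab_size F \<and> is_col F b \<and> label F (Row r) < b} =
        {b. b \<le> tab_size G \<and> is_col G b \<and> label G (Row r) < b}"
      using cols size lab[OF r(1)] by auto
    then show "F ! r = G ! r" using width[OF F r(1)] width[OF G r(2)] by simp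
  qed
qed

section \<open>Tree-tableaux as nested trees\<close>

locale ferrers_shape =
  fixes F :: "nat list"
  assumes ferrers: "ferrers F"

sublocale ferrers_shape \<subseteq> border_steps "tab_size F" "is_col F"
  by (rule border_steps_ferrers[OF ferrers])

context ferrers_shape
begin

abbreviation "n \<equiv> tab_size F"
abbreviation "col \<equiv> is_col F"
abbreviation "ix \<equiv> index F"

lemma row_exI: "r < nrows F \<Longrightarrow> \<exists>a\<le>n. \<not> col a \<and> ix a = r"
  using row_label[OF ferrers] by blast

lemma col_exI: "c < ncols F \<Longrightarrow> \<exists>b\<le>n. col b \<and> ix b = c"
  using col_label[OF ferrers] by blast

lemma ix_inj: "a \<le> n \<Longrightarrow> b \<le> n \<Longrightarrow> col a = col b \<Longrightarrow> ix a = ix b \<longleftrightarrow> a = b"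
  using label_index[OF ferrers] by metis

lemma dot_above_iff:
  assumes "D \<subseteq> cells F" "a \<le> n" "\<not> col a"
  shows "(\<exists>r<ix a. (r, c) \<in> D) \<longleftrightarrow> (\<exists>a'<a. \<not> col a' \<and> (ix a', c) \<in> D)"
proof
  assume "\<exists>r<ix a. (r, c) \<in> D"
  then obtain r where r: "r < ix a" "(r, c) \<in> D" by blast
  then obtain a' where "a' \<le> n" "\<not> col a'" "ix a' = r"
    using row_exI cellD(1)[OF ferrers] assms by blast
  then show "\<exists>a'<a. \<not> col a' \<and> (ix a', c) \<in> D"
    using r row_index_less_iff[OF ferrers, of a' a] assms by blast
next
  assume "\<exists>a'<a. \<not> col a' \<and> (ix a', c) \<in> D"
  then obtain a' where a': "a' < a" "\<not> col a'" "(ix a', c) \<in> D" by blast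
  then have "ix a' < ix a" using row_index_less_iff[OF ferrers, of a' a] assms by simp
  then show "\<exists>r<ix a. (r, c) \<in> D" using a' by blast
qed

lemma dot_left_iff:
  assumes "D \<subseteq> cells F" "b \<le> n" "col b"
  shows "(\<exists>c<ix b. (r, c) \<in> D) \<longleftrightarrow> (\<exists>b'\<le>n. b < b' \<and> col b' \<and> (r, ix b') \<in> D)"
proof
  assume "\<exists>c<ix b. (r, c) \<in> D"
  then obtain c where c: "c < ix b" "(r, c) \<in> D" by blast
  then obtain b' where "b' \<le> n" "col b'" "ix b' = c"
    using col_exI cellD(2)[OF ferrers] assms by blast
  then show "\<exists>b'\<le>n. b < b' \<and> col b' \<and> (r, ix b') \<in> D"
    using c col_index_less_iff[OF ferrers, of b' b] assms by blast
next
  assume "\<exists>b'\<le>n. b < b' \<and> col b' \<and> (r, ix b') \<in> D"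
  then obtain b' where b': "b' \<le> n" "b < b'" "col b'" "(r, ix b') \<in> D" by blast
  then have "ix b' < ix b" using col_index_less_iff[OF ferrers, of b' b] assms by simp
  then show "\<exists>c<ix b. (r, c) \<in> D" using b' by blast
qed

text \<open>
  The definition of tree-tableaux carried over to labels: above means a smaller row label, to the
  left means a larger column label.
\<close>

lemma tree_tableaux_iff:
  "D \<in> tree_tableaux F \<longleftrightarrow> D \<subseteq> cells F \<and> (ix 0, ix n) \<in> D \<and>
     (\<forall>a\<le>n. \<forall>b\<le>n. \<not> col a \<longrightarrow> col b \<longrightarrow> (ix a, ix b) \<in> D \<longrightarrow> \<not> (a = 0 \<and> b = n) \<longrightarrow>
        (\<exists>a'<a. \<not> col a' \<and> (ix a', ix b) \<in> D) \<noteq> (\<exists>b'\<le>n. b < b' \<and> col b' \<and> (ix a, ix b') \<in> D)) \<and>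
     (\<forall>a\<le>n. \<not> col a \<longrightarrow> (\<exists>b\<le>n. col b \<and> (ix a, ix b) \<in> D)) \<and>
     (\<forall>b\<le>n. col b \<longrightarrow> (\<exists>a\<le>n. \<not> col a \<and> (ix a, ix b) \<in> D))"
  (is "_ \<longleftrightarrow> ?R")
proof (cases "D \<subseteq> cells F")
  case sub: True
  \<comment> \<open>The corner cell lies in the top row, labeled \<open>0\<close>, and the leftmost column, labeled
    \<open>n\<close>.\<close>
  have corner: "ix a = 0 \<and> ix b = 0 \<longleftrightarrow> a = 0 \<and> b = n" if "a \<le> n" "b \<le> n" "\<not> col a" "col b" for a b
    using ix_inj[of a 0] ix_inj[of b n] index_top[OF ferrers] that not_col_0 col_n by auto
  have dot: "\<exists>a\<le>n. \<exists>b\<le>n. \<not> col a \<and> col b \<and> ix a = r \<and> ix b = c" if "(r, c) \<in> D" for r c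
    using that sub cellD(1,2)[OF ferrers, of r c] row_exI[of r] col_exI[of c] by blast
  have 1: "(\<forall>(r, c)\<in>D. (r, c) \<noteq> (0, 0) \<longrightarrow> ((\<exists>r'<r. (r', c) \<in> D) \<noteq> (\<exists>c'<c. (r, c') \<in> D))) \<longleftrightarrow>
     (\<forall>a\<le>n. \<forall>b\<le>n. \<not> col a \<longrightarrow> col b \<longrightarrow> (ix a, ix b) \<in> D \<longrightarrow> \<not> (a = 0 \<and> b = n) \<longrightarrow>
        (\<exists>a'<a. \<not> col a' \<and> (ix a', ix b) \<in> D) \<noteq> (\<exists>b'\<le>n. b < b' \<and> col b' \<and> (ix a, ix b') \<in> D))"
    (is "?A \<longleftrightarrow> ?B")
  proof
    assume A: ?A
    show ?B
    proof (intro allI impI)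
      fix a b assume ab: "a \<le> n" "b \<le> n" "\<not> col a" "col b" "(ix a, ix b) \<in> D" "\<not> (a = 0 \<and> b = n)"
      have "(ix a, ix b) \<noteq> (0, 0)" using corner[OF ab(1-4)] ab(6) by simp
      then have "(\<exists>r'<ix a. (r', ix b) \<in> D) \<noteq> (\<exists>c'<ix b. (ix a, c') \<in> D)" 
        using bspec[OF A ab(5)] unfolding split_beta fst_conv snd_conv by (rule rev_mp)
      then show "(\<exists>a'<a. \<not> col a' \<and> (ix a', ix b) \<in> D) \<noteq> (\<exists>b'\<le>n. b < b' \<and> col b' \<and> (ix a, ix b') \<in> D)"
        unfolding dot_above_iff[OF sub ab(1,3)] dot_left_iff[OF sub ab(2,4)] .
    qed
  next
    assume B: ?B
    have *: "(\<exists>r'<r. (r', c) \<in> D) \<noteq> (\<exists>c'<c. (r, c') \<in> D)" if rc: "(r, c) \<in> D" "(r, c) \<noteq> (0, 0)" for r c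
    proof -
      obtain a b where ab: "a \<le> n" "b \<le> n" "\<not> col a" "col b" "ix a = r" "ix b = c"
        using dot[OF rc(1)] by blast
      have "\<not> (a = 0 \<and> b = n)" using corner[OF ab(1-4)] rc(2) ab(5,6) by simp
      then have "(\<exists>a'<a. \<not> col a' \<and> (ix a', ix b) \<in> D) \<noteq> (\<exists>b'\<le>n. b < b' \<and> col b' \<and> (ix a, ix b') \<in> D)"
        using B[rule_format, OF ab(1-4)] rc(1) ab(5,6) by simp
      then show ?thesis
        unfolding dot_above_iff[OF sub ab(1,3), symmetric] dot_left_iff[OF sub ab(2,4), symmetric]
        using ab(5,6) by simp
    qed
    show ?A by (intro ballI, unfold split_beta, intro impI, rule *) simp_all
  qed
  have 2: "(\<forall>r<nrows F. \<exists>c. (r, c) \<in> D) \<longleftrightarrow> (\<forall>a\<le>n. \<not> col a \<longrightarrow> (\<exists>b\<le>n. col b \<and> (ix a, ix b) \<in> D))"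
    using dot row_exI index_less(1)[OF ferrers] by metis
  have 3: "(\<forall>c<ncols F. \<exists>r. (r, c) \<in> D) \<longleftrightarrow> (\<forall>b\<le>n. col b \<longrightarrow> (\<exists>a\<le>n. \<not> col a \<and> (ix a, ix b) \<in> D))"
    using dot col_exI index_less(2)[OF ferrers] by metis
  show ?thesis unfolding tree_tableaux_def mem_Collect_eq 1 2 3 index_top[OF ferrers] ..
next
  case False
  then show ?thesis by (auto simp: tree_tableaux_def)
qed

text \<open>
  The dot owned by the line \<open>x\<close>: the cell in which it meets its parent.
\<close>

definition edge :: "(nat \<Rightarrow> nat) \<Rightarrow> nat \<Rightarrow> nat \<times> nat" where
  "edge par x = (if col x then (ix (par x), ix x) else (ix x, ix (par x)))"

definition tree_of :: "(nat \<Rightarrow> nat) \<Rightarrow> (nat \<times> nat) set" where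
  "tree_of par = edge par ` {0<..n}"

lemma edge_eq_iff:
  assumes par: "nested par" and x: "0 < x" "x \<le> n" and ab: "a \<le> n" "b \<le> n" "\<not> col a" "col b"
  shows "edge par x = (ix a, ix b) \<longleftrightarrow> (x = b \<and> par b = a) \<or> (x = a \<and> par a = b)"
proof -
  note p = nestedD(1,2)[OF par x]
  show ?thesis
  proof (cases "col x")
    case True
    then have "edge par x = (ix a, ix b) \<longleftrightarrow> par x = a \<and> x = b"
      using ix_inj[of "par x" a] ix_inj[of x b] p x ab by (simp add: edge_def)
    then show ?thesis using True ab by auto
  next
    case False
    then have "edge par x = (ix a, ix b) \<longleftrightarrow> par x = b \<and> x = a"
      using ix_inj[of "par x" b] ix_inj[of x a] p x ab by (auto simp: edge_def)
    then show ?thesis using False ab by auto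
  qed
qed

lemma tree_of_iff:
  assumes par: "nested par" and ab: "a \<le> n" "b \<le> n" "\<not> col a" "col b"
  shows "(ix a, ix b) \<in> tree_of par \<longleftrightarrow> par b = a \<or> (0 < a \<and> par a = b)"
proof -
  have "0 < b" using ab not_col_0 by (metis gr0I)
  have "(ix a, ix b) \<in> tree_of par \<longleftrightarrow> (\<exists>x. 0 < x \<and> x \<le> n \<and> edge par x = (ix a, ix b))"
    unfolding tree_of_def image_iff by (metis greaterThanAtMost_iff)
  also have "\<dots> \<longleftrightarrow> (\<exists>x. 0 < x \<and> x \<le> n \<and> ((x = b \<and> par b = a) \<or> (x = a \<and> par a = b)))"
    using edge_eq_iff[OF par _ _ ab] by blast
  finally show ?thesis using ab \<open>0 < b\<close> by blast
qed

text \<open>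
  The leftmost column has the largest label, so nothing can lie beyond it and only the root can be
  its parent.
\<close>

lemma par_last:
  assumes par: "nested par"
  shows "par n = 0"
proof (rule ccontr)
  assume "par n \<noteq> 0"
  then have "below True n (par (par n))" using nestedD(4)[OF par n_pos] col_n by simp
  moreover have "par (par n) \<le> n"
    using nestedD(1)[OF par] nestedD(1)[OF par n_pos] \<open>par n \<noteq> 0\<close> by simp
  ultimately show False by (simp add: below_def)
qed

lemma nested_col:
  assumes "nested par" "b \<le> n" "col b"
  shows "par b < b" "\<not> col (par b)" "par b \<noteq> 0 \<Longrightarrow> b < par (par b)"
  using nestedD[OF assms(1) _ assms(2)] assms(3) not_col_0 by (cases "b = 0"; auto simp: below_def)+

lemma nested_row:
  assumes "nested par" "0 < a" "a \<le> n" "\<not> col a"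
  shows "a < par a" "par a \<le> n" "col (par a)" "par (par a) < a"
proof -
  show *: "a < par a" "par a \<le> n" "col (par a)" using nestedD[OF assms(1-3)] assms(4) by (auto simp: below_def)
  then have "par a \<noteq> 0" by simp
  then show "par (par a) < a" using nestedD(4)[OF assms(1-3)] assms(4) by (auto simp: below_def)
qed

text \<open>
  The dot owned by a column is its topmost one, so there is none above it, but there is one to its
  left: the dot owned by its parent row, which by nesting is further left. For the dot owned by a
  row the roles of above and left are exchanged. The top row owns no dot; in it the corner, which is
  the dot owned by the leftmost column, takes this part.
\<close>

lemma tree_of_tree_tableau:
  assumes par: "nested par"
  shows "tree_of par \<in> tree_tableaux F"
proof -
  have "edge par x \<in> cells F" if "0 < x" "x \<le> n" for x
  proof (cases "col x")
    case True
    then show ?thesis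
      using nested_col[OF par that(2)] index_cell_iff[OF ferrers, of "par x" x] that by (simp add: edge_def)
  next
    case False
    then show ?thesis
      using nested_row[OF par that] index_cell_iff[OF ferrers, of x "par x"] that by (simp add: edge_def)
  qed
  then have sub: "tree_of par \<subseteq> cells F" by (auto simp: tree_of_def)
  have above: "(\<exists>a'<a. \<not> col a' \<and> (ix a', ix b) \<in> tree_of par) \<longleftrightarrow> par b < a"
    if ab: "a \<le> n" "b \<le> n" "col b" "par b = a \<or> par a = b \<and> 0 < a" for a b
  proof
    assume "\<exists>a'<a. \<not> col a' \<and> (ix a', ix b) \<in> tree_of par"
    then obtain a' where a': "a' < a" "\<not> col a'" "par b = a' \<or> 0 < a' \<and> par a' = b"
      using tree_of_iff[OF par _ ab(2) _ ab(3)] ab(1) by (meson less_imp_le_nat order_less_le_trans)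
    then show "par b < a" using nested_row(4)[OF par, of a'] ab by auto
  next
    assume "par b < a"
    then show "\<exists>a'<a. \<not> col a' \<and> (ix a', ix b) \<in> tree_of par"
      using tree_of_iff[OF par, of "par b" b] nested_col[OF par ab(2,3)] ab by auto
  qed
  have left: "(\<exists>b'\<le>n. b < b' \<and> col b' \<and> (ix a, ix b') \<in> tree_of par) \<longleftrightarrow>
      (if a = 0 then b < n else b < par a)"
    if ab: "a \<le> n" "b \<le> n" "\<not> col a" "col b" "par b = a \<or> par a = b \<and> 0 < a" for a b
  proof
    assume "\<exists>b'\<le>n. b < b' \<and> col b' \<and> (ix a, ix b') \<in> tree_of par"
    then obtain b' where b': "b' \<le> n" "b < b'" "col b'" "par b' = a \<or> 0 < a \<and> par a = b'"
      using tree_of_iff[OF par ab(1) _ ab(3)] by blast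
    then show "if a = 0 then b < n else b < par a" using nested_col(3)[OF par, of b'] ab by auto
  next
    assume *: "if a = 0 then b < n else b < par a"
    show "\<exists>b'\<le>n. b < b' \<and> col b' \<and> (ix a, ix b') \<in> tree_of par"
    proof (cases "a = 0")
      case True
      then show ?thesis
        using * tree_of_iff[OF par, of 0 n] par_last[OF par] not_col_0 col_n by auto
    next
      case False
      then show ?thesis
        using * tree_of_iff[OF par, of a "par a"] nested_row[OF par _ ab(1)] ab by auto
    qed
  qed
  show ?thesis
    unfolding tree_tableaux_iff
  proof (intro conjI allI impI)
    show "(ix 0, ix n) \<in> tree_of par"
      using tree_of_iff[OF par, of 0 n] par_last[OF par] not_col_0 col_n by simp
    fix a b assume ab: "a \<le> n" "b \<le> n" "\<not> col a" "col b" "(ix a, ix b) \<in> tree_of par" "\<not> (a = 0 \<and> b = n)"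
    then have dot: "par b = a \<or> par a = b \<and> 0 < a" using tree_of_iff[OF par] by blast
    have "par b < a \<longleftrightarrow> \<not> (if a = 0 then b < n else b < par a)"
    proof (cases "par b = a")
      case True
      then show ?thesis using nested_col(3)[OF par ab(2,4)] ab by auto
    next
      case False
      then show ?thesis using nested_row[OF par _ ab(1,3)] dot by auto
    qed
    then show "(\<exists>a'<a. \<not> col a' \<and> (ix a', ix b) \<in> tree_of par) \<noteq>
        (\<exists>b'\<le>n. b < b' \<and> col b' \<and> (ix a, ix b') \<in> tree_of par)"
      using above[OF ab(1,2,4) dot] left[OF ab(1-4) dot] by simp
  next
    fix a assume a: "a \<le> n" "\<not> col a"
    show "\<exists>b\<le>n. col b \<and> (ix a, ix b) \<in> tree_of par"
    proof (cases "a = 0")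
      case True
      then show ?thesis
        using tree_of_iff[OF par, of 0 n] par_last[OF par] not_col_0 col_n by auto
    next
      case False
      then show ?thesis
        using tree_of_iff[OF par, of a "par a"] nested_row[OF par _ a] a by auto
    qed
  next
    fix b assume b: "b \<le> n" "col b"
    then show "\<exists>a\<le>n. \<not> col a \<and> (ix a, ix b) \<in> tree_of par"
      using tree_of_iff[OF par, of "par b" b] nested_col[OF par b] by (intro exI[of _ "par b"]) auto
  qed (use sub in auto)
qed

text \<open>
  Let the parent of a column be the row of its topmost dot and the parent of a row the column of its
  leftmost dot. Unless it is the corner, such a dot fails one of the alternatives above or left, so it
  satisfies the other, which is the nesting condition. Conversely every other dot fails one of them and hence is the topmost
  dot of its column or the leftmost one of its row.
\<close>

lemma tree_tableau_tree_of:
  assumes "D \<in> tree_tableaux F"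
  obtains par where "nested par" "D = tree_of par"
proof -
  have sub: "D \<subseteq> cells F" and root: "(ix 0, ix n) \<in> D"
    and one: "\<And>a b. a \<le> n \<Longrightarrow> b \<le> n \<Longrightarrow> \<not> col a \<Longrightarrow> col b \<Longrightarrow> (ix a, ix b) \<in> D \<Longrightarrow> \<not> (a = 0 \<and> b = n) \<Longrightarrow>
        (\<exists>a'<a. \<not> col a' \<and> (ix a', ix b) \<in> D) \<noteq> (\<exists>b'\<le>n. b < b' \<and> col b' \<and> (ix a, ix b') \<in> D)"
    and rows: "\<And>a. a \<le> n \<Longrightarrow> \<not> col a \<Longrightarrow> \<exists>b\<le>n. col b \<and> (ix a, ix b) \<in> D"
    and cols: "\<And>b. b \<le> n \<Longrightarrow> col b \<Longrightarrow> \<exists>a\<le>n. \<not> col a \<and> (ix a, ix b) \<in> D"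
    using assms unfolding tree_tableaux_iff by blast+
  have less: "a < b" if "a \<le> n" "b \<le> n" "\<not> col a" "col b" "(ix a, ix b) \<in> D" for a b
    using that sub index_cell_iff[OF ferrers that(1-4)] by blast
  let ?T = "\<lambda>b. {a. a \<le> n \<and> \<not> col a \<and> (ix a, ix b) \<in> D}"
  let ?L = "\<lambda>a. {b. b \<le> n \<and> col b \<and> (ix a, ix b) \<in> D}"
  define par where "par x = (if col x then Min (?T x) else Max (?L x))" for x
  have top: "par b \<le> n" "\<not> col (par b)" "(ix (par b), ix b) \<in> D"
    "\<And>a. a \<le> n \<Longrightarrow> \<not> col a \<Longrightarrow> (ix a, ix b) \<in> D \<Longrightarrow> par b \<le> a"
    if b: "b \<le> n" "col b" for b
  proof -
    have "Min (?T b) \<in> ?T b" using cols[OF b] by (intro Min_in) auto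
    then show "par b \<le> n" "\<not> col (par b)" "(ix (par b), ix b) \<in> D" using b by (auto simp: par_def)
    show "par b \<le> a" if "a \<le> n" "\<not> col a" "(ix a, ix b) \<in> D" for a
      using that b Min_le[of "?T b" a] by (simp add: par_def)
  qed
  have left: "par a \<le> n" "col (par a)" "(ix a, ix (par a)) \<in> D"
    "\<And>b. b \<le> n \<Longrightarrow> col b \<Longrightarrow> (ix a, ix b) \<in> D \<Longrightarrow> b \<le> par a"
    if a: "a \<le> n" "\<not> col a" for a
  proof -
    have "Max (?L a) \<in> ?L a" using rows[OF a] by (intro Max_in) auto
    then show "par a \<le> n" "col (par a)" "(ix a, ix (par a)) \<in> D" using a by (auto simp: par_def)
    show "b \<le> par a" if "b \<le> n" "col b" "(ix a, ix b) \<in> D" for b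
      using that a Max_ge[of "?L a" b] by (simp add: par_def)
  qed
  have "nested par"
    unfolding nested_def
  proof (intro allI impI)
    fix x assume x: "0 < x \<and> x \<le> n"
    show "par x \<le> n \<and> col (par x) \<noteq> col x \<and> below (col x) (par x) x \<and>
        (par x \<noteq> 0 \<longrightarrow> below (col x) x (par (par x)))"
    proof (cases "col x")
      case True
      note t = top[OF _ True]
      have "x < par (par x)" if nz: "par x \<noteq> 0"
      proof -
        have "\<not> (\<exists>a'<par x. \<not> col a' \<and> (ix a', ix x) \<in> D)"
          using t(1,4) x by (meson leD less_imp_le_nat order_less_le_trans)
        then obtain b' where "b' \<le> n" "x < b'" "col b'" "(ix (par x), ix b') \<in> D"
          using one[of "par x" x] t x True nz by blast
        then show ?thesis using left(4)[of "par x" b'] t x by simp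
      qed
      then show ?thesis using t(1-3) x less[of "par x" x] True by (auto simp: below_def)
    next
      case False
      note t = left[OF _ False]
      have "\<not> (\<exists>b'\<le>n. par x < b' \<and> col b' \<and> (ix x, ix b') \<in> D)" using t(4) x by (meson leD)
      then obtain a' where a': "a' < x" "\<not> col a'" "(ix a', ix (par x)) \<in> D"
        using one[of x "par x"] t x False by blast
      then have "par (par x) < x" using top(4)[of "par x" a'] t x by simp
      then show ?thesis using t(1-3) x less[of x "par x"] False by (auto simp: below_def)
    qed
  qed
  moreover have "D = tree_of par"
  proof -
    have iff: "(ix a, ix b) \<in> D \<longleftrightarrow> (ix a, ix b) \<in> tree_of par"
      if ab: "a \<le> n" "b \<le> n" "\<not> col a" "col b" for a b
      unfolding tree_of_iff[OF \<open>nested par\<close> ab]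
    proof
      assume d: "(ix a, ix b) \<in> D"
      show "par b = a \<or> 0 < a \<and> par a = b"
      proof (cases "\<exists>a'<a. \<not> col a' \<and> (ix a', ix b) \<in> D")
        case True
        then have "\<not> (\<exists>b'\<le>n. b < b' \<and> col b' \<and> (ix a, ix b') \<in> D)" using one[OF ab d] by auto
        moreover have "b \<le> par a" using left(4)[OF ab(1,3,2,4) d] .
        ultimately have "par a = b" using left(1-3)[OF ab(1,3)] by (metis le_neq_implies_less)
        then show ?thesis using True by auto
      next
        case False
        moreover have "par b \<le> a" using top(4)[OF ab(2,4,1,3) d] .
        ultimately have "par b = a" using top(1-3)[OF ab(2,4)] by (metis le_neq_implies_less)
        then show ?thesis ..
      qed
    next
      assume "par b = a \<or> 0 < a \<and> par a = b"
      then show "(ix a, ix b) \<in> D" using top(3)[OF ab(2,4)] left(3)[OF ab(1,3)] by auto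
    qed
    have "tree_of par \<subseteq> cells F"
      using tree_of_tree_tableau[OF \<open>nested par\<close>] by (simp add: tree_tableaux_def)
    have "x \<in> D \<longleftrightarrow> x \<in> tree_of par" for x
    proof (cases "x \<in> cells F")
      case True
      then obtain a b where "a \<le> n" "b \<le> n" "\<not> col a" "col b" "x = (ix a, ix b)"
        using row_exI[of "fst x"] col_exI[of "snd x"] cellD[OF ferrers, of "fst x" "snd x"]
        by (metis prod.collapse)
      then show ?thesis using iff by blast
    next
      case False
      then show ?thesis using sub \<open>tree_of par \<subseteq> cells F\<close> by blast
    qed
    then show ?thesis by blast
  qed
  ultimately show thesis using that by blast
qed

end

section \<open>The word of a tree-tableau is a depth-first traversal\<close>

context ferrers_shape
begin

lemma edge_labels:
  assumes "nested par" "0 < x" "x \<le> n"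
  shows "{label F (Row (fst (edge par x))), label F (Col (snd (edge par x)))} = {x, par x}"
  using nestedD(1,2)[OF assms] label_index[OF ferrers] assms by (auto simp: edge_def)

text \<open>
  Two lines sharing their dot would be parents of each other, which the nesting excludes.
\<close>

lemma inj_on_edge:
  assumes par: "nested par"
  shows "inj_on (edge par) {0<..n}"
proof (rule inj_onI)
  fix x y assume xy: "x \<in> {0<..n}" "y \<in> {0<..n}" and eq: "edge par x = edge par y"
  then have "{x, par x} = {y, par y}" using edge_labels[OF par] by (metis greaterThanAtMost_iff)
  then consider "x = y" | "par x = y" "par y = x" by (metis doubleton_eq_iff)
  then show "x = y"
  proof cases
    case 2
    then show ?thesis using nestedD(4)[OF par, of x] xy by simp
  qed
qed

lemma dots_at_line:
  assumes par: "nested par" and v: "v \<le> n"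
  shows "tree_of par \<inter> line_cells (border F ! v) = edge par ` {x \<in> {0<..n}. par x = v \<or> x = v}"
proof -
  have "edge par x \<in> line_cells (border F ! v) \<longleftrightarrow> par x = v \<or> x = v" if x: "0 < x" "x \<le> n" for x
  proof -
    note p = nestedD(1,2)[OF par x]
    have "edge par x \<in> line_cells (border F ! v) \<longleftrightarrow>
        (if col v then ix v = snd (edge par x) else ix v = fst (edge par x))"
      using border_nth[of F v] by (cases "edge par x") auto
    then show ?thesis
      using ix_inj[OF v x(2)] ix_inj[OF v p(1)] p(2) by (auto simp: edge_def)
  qed
  then show ?thesis by (auto simp: tree_of_def)
qed

text \<open>
  A visited line has used the dot that it owns and those of its visited children. So the dots that
  are left on it belong to its unvisited children.
\<close>

lemma unused_dots_eq:
  assumes par: "nested par" and d: "depth_first par vs" and j: "j < length vs"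
  shows "unused_dots F (tree_of par) (map (edge par) (tl vs)) (vs ! j) =
     edge par ` open_children par vs (vs ! j)"
proof -
  note d' = depth_firstD[OF d]
  have "set vs = insert 0 (set (tl vs))" "0 \<notin> set (tl vs)"
    using d'(1,2,4) by (cases vs; auto)+
  then have tl: "set (tl vs) \<subseteq> {0<..n}" "set (tl vs) = set vs - {0}"
    using d'(3) by (auto intro!: gr0I)
  have mem: "vs ! j \<in> set vs" "vs ! j \<le> n" using j d'(3) nth_mem by auto
  have "unused_dots F (tree_of par) (map (edge par) (tl vs)) (vs ! j) =
      edge par ` {x \<in> {0<..n}. par x = vs ! j \<or> x = vs ! j} - edge par ` set (tl vs)"
    unfolding unused_dots_def dots_at_line[OF par mem(2)] by simp
  also have "\<dots> = edge par ` ({x \<in> {0<..n}. par x = vs ! j \<or> x = vs ! j} - set (tl vs))"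
    by (rule inj_on_image_set_diff[OF inj_on_edge[OF par], symmetric]) (use tl(1) in auto)
  also have "{x \<in> {0<..n}. par x = vs ! j \<or> x = vs ! j} - set (tl vs) = open_children par vs (vs ! j)"
    using mem tl(2) by (auto simp: open_children_def)
  finally show ?thesis .
qed

text \<open>
  Bottommost in a column means largest row label, rightmost in a row means smallest column label:
  the child nearest to \<open>v\<close> in both cases.
\<close>

lemma outermost_edge:
  assumes par: "nested par" and v: "v \<le> n"
    and X: "X \<subseteq> {x \<in> {0<..n}. par x = v}" "x \<in> X"
    and nearest: "\<And>y. y \<in> X \<Longrightarrow> y \<noteq> x \<Longrightarrow> below (\<not> col v) x y"
  shows "outermost (border F ! v) (edge par ` X) = edge par x"
proof -
  have X': "y \<le> n" "par y = v" "col y \<longleftrightarrow> \<not> col v" if "y \<in> X" for y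
    using X(1) that nestedD(2)[OF par, of y] by auto
  have fin: "finite (ix ` X)" using finite_subset[OF X(1)] by simp
  have "ix y \<le> ix x" if "y \<in> X" for y
  proof (cases "y = x")
    case False
    then have "below (\<not> col v) x y" using nearest that by blast
    then show ?thesis
      using X'[OF that] X'[OF X(2)] row_index_less_iff[OF ferrers, of y x]
        col_index_less_iff[OF ferrers, of y x]
      by (cases "col v") (auto simp: below_def)
  qed simp
  then have max: "Max (ix ` X) = ix x" using fin X(2) by (intro Max_eqI) auto
  show ?thesis
  proof (cases "col v")
    case True
    have "edge par y = (ix y, ix v)" if "y \<in> X" for y using X'[OF that] True by (simp add: edge_def)
    then have e: "{r. (r, ix v) \<in> edge par ` X} = ix ` X" "edge par x = (ix x, ix v)"
      using X(2) by (auto simp: image_iff)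
    show ?thesis using border_nth[of F v] True e max by simp
  next
    case False
    have "edge par y = (ix v, ix y)" if "y \<in> X" for y using X'[OF that] False by (simp add: edge_def)
    then have e: "{c. (ix v, c) \<in> edge par ` X} = ix ` X" "edge par x = (ix v, ix x)"
      using X(2) by (auto simp: image_iff)
    show ?thesis using border_nth[of F v] False e max by simp
  qed
qed

lemma tau_state_depth_first:
  assumes par: "nested par"
  shows "i \<le> n \<Longrightarrow> \<exists>vs. tau_state F (tree_of par) i = (vs, map (edge par) (tl vs)) \<and>
     length vs = Suc i \<and> depth_first par vs"
proof (induction i)
  case 0
  then show ?case using depth_first_root by simp
next
  case (Suc i)
  then obtain vs where vs: "tau_state F (tree_of par) i = (vs, map (edge par) (tl vs))"
    "length vs = Suc i" and d: "depth_first par vs" by auto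
  note d' = depth_firstD[OF d]
  let ?es = "map (edge par) (tl vs)"
  let ?J = "{j. j < Suc i \<and> unused_dots F (tree_of par) ?es (vs ! j) \<noteq> {}}"
  have J: "?J = {j. j < Suc i \<and> open_children par vs (vs ! j) \<noteq> {}}"
    using unused_dots_eq[OF par d] vs(2) by auto
  define j where "j = Max ?J"
  have "?J \<noteq> {}" using depth_first_open[OF par d] Suc.prems vs(2) unfolding J by auto
  then have "j \<in> ?J" unfolding j_def by (intro Max_in) auto
  then have j: "j < length vs" "open_children par vs (vs ! j) \<noteq> {}" using vs(2) unfolding J by auto
  have last: "open_children par vs (vs ! l) = {}" if l: "j < l" "l < length vs" for l
  proof (rule ccontr)
    assume "open_children par vs (vs ! l) \<noteq> {}"
    then have "l \<in> ?J" using l vs(2) unfolding J by simp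
    then have "l \<le> j" unfolding j_def by (intro Max_ge) auto
    then show False using l by simp
  qed
  have v: "vs ! j \<le> n" using d'(3) j(1) nth_mem by auto
  let ?O = "open_children par vs (vs ! j)"
  have fin: "finite ?O" by (auto simp: open_children_def)
  obtain x where x: "x \<in> ?O" "\<And>y. y \<in> ?O \<Longrightarrow> y \<noteq> x \<Longrightarrow> below (\<not> col (vs ! j)) x y"
    by (rule below_least[OF fin j(2)]) blast
  have x': "0 < x" "x \<le> n" "par x = vs ! j" "x \<notin> set vs" using x(1) by (auto simp: open_children_def)
  have "depth_first par (vs @ [x])"
    using depth_first_step[OF par d j(1) x(1) last] x(2) nestedD(2)[OF par x'(1,2)] x'(3) by simp
  moreover have e: "outermost (border F ! (vs ! j)) (unused_dots F (tree_of par) ?es (vs ! j)) = edge par x"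
    unfolding unused_dots_eq[OF par d j(1)]
    by (rule outermost_edge[OF par v _ x]) (auto simp: open_children_def)
  moreover have "(THE v. v \<in> {label F (Row (fst (edge par x))), label F (Col (snd (edge par x)))} \<and> v \<notin> set vs) = x"
    unfolding edge_labels[OF par x'(1,2)] using x' j(1) by (auto intro!: the_equality)
  ultimately show ?case
    using vs d'(1) by (auto simp: Let_def j_def[symmetric])
qed

lemma tau_traverses:
  assumes par: "nested par"
  shows "rooted_perm (0 # tau F (tree_of par))" "traverses par (0 # tau F (tree_of par))"
proof -
  obtain vs where vs: "tau_state F (tree_of par) n = (vs, map (edge par) (tl vs))"
    "length vs = Suc n" "depth_first par vs"
    using tau_state_depth_first[OF par, of n] by auto
  have "0 # tau F (tree_of par) = vs"
    using vs(1) depth_firstD(1,4)[OF vs(3)] by (cases vs) (auto simp: tau_def)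
  then show "rooted_perm (0 # tau F (tree_of par))" "traverses par (0 # tau F (tree_of par))"
    using rooted_permI[of vs] vs(2) depth_firstD(2,3,4)[OF vs(3)] vs(3) by (auto simp: depth_first_def)
qed

lemma tau_bij: "bij_betw (\<lambda>D. 0 # tau F D) (tree_tableaux F) border_words"
proof (rule bij_betw_imageI)
  show "inj_on (\<lambda>D. 0 # tau F D) (tree_tableaux F)"
  proof (rule inj_onI)
    fix D E assume D: "D \<in> tree_tableaux F" and E: "E \<in> tree_tableaux F"
      and eq: "0 # tau F D = 0 # tau F E"
    obtain p where p: "nested p" "D = tree_of p" by (rule tree_tableau_tree_of[OF D])
    obtain q where q: "nested q" "E = tree_of q" by (rule tree_tableau_tree_of[OF E])
    have "p x = q x" if "0 < x" "x \<le> n" for x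
      using parent_unique[OF tau_traverses(1)[OF p(1)] p(1) tau_traverses(2)[OF p(1)] q(1) _ that]
        tau_traverses(2)[OF q(1)] eq p(2) q(2) by simp
    then show "D = E" unfolding p(2) q(2) tree_of_def edge_def by (auto intro!: image_cong)
  qed
  show "(\<lambda>D. 0 # tau F D) ` tree_tableaux F = border_words"
  proof
    show "(\<lambda>D. 0 # tau F D) ` tree_tableaux F \<subseteq> border_words"
    proof
      fix v assume "v \<in> (\<lambda>D. 0 # tau F D) ` tree_tableaux F"
      then obtain D where D: "D \<in> tree_tableaux F" "v = 0 # tau F D" by blast
      obtain p where p: "nested p" "D = tree_of p" by (rule tree_tableau_tree_of[OF D(1)])
      then show "v \<in> border_words"
        using tau_traverses[OF p(1)] traverses_zigzag[OF p(1)] D(2) by (simp add: border_words_def)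
    qed
    show "border_words \<subseteq> (\<lambda>D. 0 # tau F D) ` tree_tableaux F"
    proof
      fix v assume v: "v \<in> border_words"
      then obtain p where p: "nested p" "traverses p v" by (rule border_word_traverses)
      have "v = 0 # tau F (tree_of p)"
        using traversal_unique[OF p(1) _ p(2) tau_traverses[OF p(1)]] v by (simp add: border_words_def)
      then show "v \<in> (\<lambda>D. 0 # tau F D) ` tree_tableaux F"
        using tree_of_tree_tableau[OF p(1)] by blast
    qed
  qed
qed

end

section \<open>EW-tableaux as orders read greedily\<close>

context border_steps
begin

definition cell_pair :: "nat \<Rightarrow> nat \<Rightarrow> bool" where
  "cell_pair x y \<longleftrightarrow> x \<le> n \<and> y \<le> n \<and> col x \<noteq> col y \<and> below (col y) x y"

lemma cell_pair_sym: "cell_pair x y \<longleftrightarrow> cell_pair y x"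
  by (auto simp: cell_pair_def below_def)

lemma zigzag_successively: "zigzag v \<longleftrightarrow> successively (\<lambda>x y. below (col y) x y) v"
  by (simp add: zigzag_def successively_conv_nth)

end

context ferrers_shape
begin

text \<open>
  The orientation of the cells by their entries: an arrow from \<open>x\<close> to \<open>y\<close> means that
  \<open>x\<close> has to be read before \<open>y\<close>.
\<close>

definition arrow :: "filling \<Rightarrow> nat \<Rightarrow> nat \<Rightarrow> bool" where
  "arrow T x y \<longleftrightarrow> cell_pair x y \<and> (if col y then T (ix x, ix y) = 1 else T (ix y, ix x) \<noteq> 1)"

lemma arrow_cell: "arrow T x y \<Longrightarrow> cell_pair x y"
  by (simp add: arrow_def)

lemma arrow_flip: "cell_pair x y \<Longrightarrow> arrow T y x \<longleftrightarrow> \<not> arrow T x y"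
  using cell_pair_sym[of x y] by (auto simp: arrow_def cell_pair_def)

lemma arrow_into_col:
  "a \<le> n \<Longrightarrow> b \<le> n \<Longrightarrow> \<not> col a \<Longrightarrow> col b \<Longrightarrow> arrow T a b \<longleftrightarrow> a < b \<and> T (ix a, ix b) = 1"
  by (auto simp: arrow_def cell_pair_def below_def)

lemma EW_tableauxD:
  assumes "T \<in> EW_tableaux F"
  shows "T \<in> cells F \<rightarrow>\<^sub>E {0, 1}" "\<And>c. c < ncols F \<Longrightarrow> T (0, c) = 1"
    "\<And>r. 0 < r \<Longrightarrow> r < nrows F \<Longrightarrow> \<exists>c<F ! r. T (r, c) = 0"
    "\<And>r r' c c'. r < r' \<Longrightarrow> c < c' \<Longrightarrow> (r', c') \<in> cells F \<Longrightarrow>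
        \<not> (T (r, c) = 0 \<and> T (r', c') = 0 \<and> T (r, c') = 1 \<and> T (r', c) = 1)"
    "\<And>r r' c c'. r < r' \<Longrightarrow> c < c' \<Longrightarrow> (r', c') \<in> cells F \<Longrightarrow>
        \<not> (T (r, c) = 1 \<and> T (r', c') = 1 \<and> T (r, c') = 0 \<and> T (r', c) = 0)"
  using assms unfolding EW_tableaux_def by blast+

lemma EW_value:
  assumes "T \<in> EW_tableaux F" "(r, c) \<in> cells F"
  shows "T (r, c) \<noteq> 1 \<longleftrightarrow> T (r, c) = 0"
  using PiE_mem[OF EW_tableauxD(1)[OF assms(1)] assms(2)] by auto

lemma arrow_into_row:
  assumes "T \<in> EW_tableaux F" "a \<le> n" "b \<le> n" "\<not> col a" "col b"
  shows "arrow T b a \<longleftrightarrow> a < b \<and> T (ix a, ix b) = 0"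
  using EW_value[OF assms(1), of "ix a" "ix b"] index_cell_iff[OF ferrers assms(2-5)] assms(2-5)
  by (auto simp: arrow_def cell_pair_def below_def)

lemma EW_arrow_from_top:
  assumes "T \<in> EW_tableaux F"
  shows "\<not> arrow T y 0"
proof
  assume y: "arrow T y 0"
  then have "y \<le> n" "col y" using not_col_0 by (auto simp: arrow_def cell_pair_def)
  then show False
    using y EW_tableauxD(2)[OF assms, of "ix y"] index_less(2)[OF ferrers] index_top[OF ferrers] not_col_0
    by (auto simp: arrow_def)
qed

lemma EW_arrow_into_row:
  assumes T: "T \<in> EW_tableaux F" and a: "0 < a" "a \<le> n" "\<not> col a"
  shows "\<exists>b. b \<noteq> 0 \<and> arrow T b a"
proof -
  have "ix a < nrows F" using index_less(1)[OF ferrers a(2,3)] .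
  moreover have "0 < ix a"
    using row_index_less_iff[OF ferrers, of 0 a] index_top[OF ferrers] a not_col_0 by simp
  ultimately obtain c where c: "(ix a, c) \<in> cells F" "T (ix a, c) = 0"
    using EW_tableauxD(3)[OF T] by (auto simp: cells_def)
  obtain b where b: "b \<le> n" "col b" "ix b = c" using col_exI cellD(2)[OF ferrers c(1)] by blast
  then have "arrow T b a"
    using arrow_into_row[OF T a(2) b(1) a(3) b(2)] index_cell_iff[OF ferrers a(2) b(1) a(3) b(2)] c by simp
  moreover have "b \<noteq> 0" using b not_col_0 by metis
  ultimately show ?thesis by blast
qed

text \<open>
  The two forbidden rectangles are the two orientations of a cycle through two rows and two columns;
  which of them occurs depends on the order of the columns.
\<close>

lemma EW_no_cycle_ordered:
  assumes T: "T \<in> EW_tableaux F" and rows: "\<not> col x" "\<not> col z" "x < z"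
    and arrows: "arrow T x y" "arrow T y z" "arrow T z w" "arrow T w x"
  shows False
proof -
  have le: "x \<le> n" "y \<le> n" "z \<le> n" "w \<le> n" and cols: "col y" "col w"
    using arrows rows by (auto simp: arrow_def cell_pair_def)
  have vals: "T (ix x, ix y) = 1" "T (ix z, ix y) = 0" "T (ix z, ix w) = 1" "T (ix x, ix w) = 0"
    and less: "z < y" "z < w"
    using arrows arrow_into_col[OF le(1,2) rows(1) cols(1)] arrow_into_row[OF T le(3,2) rows(2) cols(1)]
      arrow_into_col[OF le(3,4) rows(2) cols(2)] arrow_into_row[OF T le(1,4) rows(1) cols(2)] by auto
  have xz: "ix x < ix z" using row_index_less_iff[OF ferrers le(1,3) rows(1,2)] rows by simp
  have cells: "(ix z, ix y) \<in> cells F" "(ix z, ix w) \<in> cells F"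
    using index_cell_iff[OF ferrers] le rows cols less by auto
  have "ix y \<noteq> ix w" using vals by auto
  then consider "ix y < ix w" | "ix w < ix y" by linarith
  then show False
  proof cases
    case 1
    then show False using EW_tableauxD(5)[OF T xz 1 cells(2)] vals by simp
  next
    case 2
    then show False using EW_tableauxD(4)[OF T xz 2 cells(1)] vals by simp
  qed
qed

lemma EW_no_cycle:
  assumes T: "T \<in> EW_tableaux F" and row: "\<not> col x"
    and arrows: "arrow T x y" "arrow T y z" "arrow T z w" "arrow T w x"
  shows False
proof -
  have z: "\<not> col z" using arrows row by (auto simp: arrow_def cell_pair_def)
  have "x \<noteq> z" using arrows arrow_flip[of x y T] arrow_cell by blast
  then consider "x < z" | "z < x" by linarith
  then show False
    using EW_no_cycle_ordered[OF T row z _ arrows] EW_no_cycle_ordered[OF T z row _ arrows(3,4,1,2)]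
    by cases auto
qed

text \<open>
  Suppose that every line of \<open>U\<close> has an arrow into it from \<open>U\<close>, and let \<open>r\<close>
  be the bottommost row in \<open>U\<close>. By induction the lines of \<open>U\<close> other than
  \<open>r\<close> contain some \<open>x\<close> whose incoming arrows all come from \<open>r\<close>. Follow arrows
  back from \<open>r\<close> to a column \<open>c\<close> and on to a row \<open>s\<close>. As \<open>s\<close> lies
  above \<open>r\<close>, it also meets \<open>x\<close>, and the arrow in that cell must leave \<open>x\<close>.
  This closes a cycle of length four.
\<close>

lemma EW_source_exists:
  assumes T: "T \<in> EW_tableaux F" and U: "finite U" "U \<noteq> {}"
  shows "\<exists>x\<in>U. \<forall>y\<in>U. \<not> arrow T y x"
  using U
proof (induction "card U" arbitrary: U rule: less_induct)
  case less
  show ?case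
  proof (rule ccontr)
    assume "\<not> ?case"
    then have into: "\<And>x. x \<in> U \<Longrightarrow> \<exists>y\<in>U. arrow T y x" by blast
    let ?R = "{x \<in> U. \<not> col x}"
    obtain x0 where "x0 \<in> U" using less.prems by blast
    then obtain y0 where "y0 \<in> U" "arrow T y0 x0" using into by blast
    then have "x0 \<in> ?R \<or> y0 \<in> ?R" using \<open>x0 \<in> U\<close> by (auto simp: arrow_def cell_pair_def)
    then have "?R \<noteq> {}" by blast
    moreover have "finite ?R" using less.prems by simp
    ultimately have "Max ?R \<in> ?R" "\<And>s. s \<in> ?R \<Longrightarrow> s \<le> Max ?R"
      using Max_in[of ?R] Max_ge[of ?R] by blast+
    then obtain r where rU: "r \<in> U" "\<not> col r" and bottom: "\<And>s. s \<in> U \<Longrightarrow> \<not> col s \<Longrightarrow> s \<le> r"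
      by blast
    obtain c where c: "c \<in> U" "arrow T c r" using into rU by blast
    then have cr: "c \<noteq> r" by (auto simp: arrow_def cell_pair_def)
    have "card (U - {r}) < card U" using rU less.prems by (meson card_Diff1_less)
    then obtain x where x: "x \<in> U" "x \<noteq> r" "\<And>y. y \<in> U \<Longrightarrow> y \<noteq> r \<Longrightarrow> \<not> arrow T y x"
      using less.hyps[of "U - {r}"] c(1) cr less.prems(1) by blast
    then have rx: "arrow T r x" using into by blast
    obtain s where s: "s \<in> U" "arrow T s c" using into c by blast
    have "s \<noteq> r" using s c arrow_flip[of r c T] arrow_cell by blast
    moreover have col_s: "\<not> col s" using s c rU by (auto simp: arrow_def cell_pair_def)
    ultimately have "s < r" using bottom s(1) by (simp add: le_neq_implies_less)
    then have "cell_pair s x" using rx rU col_s by (auto simp: arrow_def cell_pair_def below_def)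
    then have "arrow T x s" using x(3)[OF s(1) \<open>s \<noteq> r\<close>] arrow_flip by blast
    then show False using EW_no_cycle[OF T col_s s(2) c(2) rx] by blast
  qed
qed

text \<open>
  The lines without an arrow into them from an unread line, \<open>v\<close> being the list of lines read
  so far with the top row \<open>0\<close> in front.
\<close>

definition ready :: "filling \<Rightarrow> nat list \<Rightarrow> nat \<Rightarrow> bool" where
  "ready T v x \<longleftrightarrow> x \<le> n \<and> x \<notin> set v \<and> \<not> (\<exists>y. y \<notin> set v \<and> arrow T y x)"

lemma concat_map_filter: "concat (map (\<lambda>x. if P x then [f x] else []) xs) = map f (filter P xs)"
  by (induction xs) auto

lemma remaining_iff:
  assumes "a \<le> n" "b \<le> n" "\<not> col a" "col b"
  shows "(ix a, ix b) \<in> remaining F w \<longleftrightarrow> a < b \<and> a \<notin> set (0 # w) \<and> b \<notin> set (0 # w)"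
  using index_cell_iff[OF ferrers assms] label_index[OF ferrers] assms not_col_0
    ix_inj[of a 0] index_top[OF ferrers]
  by (auto simp: remaining_def)

text \<open>
  The test by which the reading process selects columns, and likewise rows in the next lemma, asks
  for unread arrows: an entry 1 in a column is an arrow into the column, an entry 0 in a row is an
  arrow into the row.
\<close>

lemma ready_col_iff:
  assumes c: "c < ncols F"
  shows "ready T (0 # w) (label F (Col c)) \<longleftrightarrow>
     label F (Col c) \<notin> set w \<and> \<not> (\<exists>r. (r, c) \<in> remaining F w \<and> T (r, c) = 1)"
proof -
  let ?b = "label F (Col c)"
  note b = col_label[OF ferrers c]
  have nz: "?b \<noteq> 0" using b not_col_0 by metis
  have iff: "(\<exists>y. y \<notin> set (0 # w) \<and> arrow T y ?b) \<longleftrightarrow> (\<exists>r. (r, c) \<in> remaining F w \<and> T (r, c) = 1)"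
    if new: "?b \<notin> set w"
  proof
    assume "\<exists>y. y \<notin> set (0 # w) \<and> arrow T y ?b"
    then obtain y where y: "y \<notin> set (0 # w)" "arrow T y ?b" by blast
    then have "y \<le> n" "\<not> col y" using b by (auto simp: arrow_def cell_pair_def)
    then show "\<exists>r. (r, c) \<in> remaining F w \<and> T (r, c) = 1"
      using remaining_iff[of y ?b w] arrow_into_col[of y ?b T] y b new nz by auto
  next
    assume "\<exists>r. (r, c) \<in> remaining F w \<and> T (r, c) = 1"
    then obtain r where r: "(r, c) \<in> remaining F w" "T (r, c) = 1" by blast
    then obtain a where a: "a \<le> n" "\<not> col a" "ix a = r"
      using row_exI cellD(1)[OF ferrers, of r c] by (auto simp: remaining_def)
    then show "\<exists>y. y \<notin> set (0 # w) \<and> arrow T y ?b"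
      using remaining_iff[of a ?b w] arrow_into_col[of a ?b T] r b by auto
  qed
  show ?thesis
  proof (cases "?b \<in> set w")
    case True
    then show ?thesis by (simp add: ready_def)
  next
    case False
    then show ?thesis unfolding ready_def iff[OF False] using b(1) nz by simp
  qed
qed

lemma ready_row_iff:
  assumes T: "T \<in> EW_tableaux F" and r: "0 < r" "r < nrows F"
  shows "ready T (0 # w) (label F (Row r)) \<longleftrightarrow>
     label F (Row r) \<notin> set w \<and> \<not> (\<exists>c. (r, c) \<in> remaining F w \<and> T (r, c) = 0)"
proof -
  let ?a = "label F (Row r)"
  note a = row_label[OF ferrers r(2)]
  have nz: "?a \<noteq> 0" using a(3) index_top[OF ferrers] r(1) by (metis less_irrefl)
  have iff: "(\<exists>y. y \<notin> set (0 # w) \<and> arrow T y ?a) \<longleftrightarrow> (\<exists>c. (r, c) \<in> remaining F w \<and> T (r, c) = 0)"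
    if new: "?a \<notin> set w"
  proof
    assume "\<exists>y. y \<notin> set (0 # w) \<and> arrow T y ?a"
    then obtain y where y: "y \<notin> set (0 # w)" "arrow T y ?a" by blast
    then have "y \<le> n" "col y" using a by (auto simp: arrow_def cell_pair_def)
    then show "\<exists>c. (r, c) \<in> remaining F w \<and> T (r, c) = 0"
      using remaining_iff[of ?a y w] arrow_into_row[OF T, of ?a y] y a new nz by auto
  next
    assume "\<exists>c. (r, c) \<in> remaining F w \<and> T (r, c) = 0"
    then obtain c where c: "(r, c) \<in> remaining F w" "T (r, c) = 0" by blast
    then obtain b where b: "b \<le> n" "col b" "ix b = c"
      using col_exI cellD(2)[OF ferrers, of r c] by (auto simp: remaining_def)
    then show "\<exists>y. y \<notin> set (0 # w) \<and> arrow T y ?a"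
      using remaining_iff[of ?a b w] arrow_into_row[OF T, of ?a b] c a by auto
  qed
  show ?thesis
  proof (cases "?a \<in> set w")
    case True
    then show ?thesis by (simp add: ready_def)
  next
    case False
    then show ?thesis unfolding ready_def iff[OF False] using a(1) nz by simp
  qed
qed

text \<open>
  What one half-round reads, described without reference to the numbering of rows and columns: all
  ready lines of kind \<open>k\<close>, moving away from the lines that meet them.
\<close>

definition block :: "filling \<Rightarrow> bool \<Rightarrow> nat list \<Rightarrow> nat list \<Rightarrow> bool" where
  "block T k v u \<longleftrightarrow> sorted_wrt (below k) u \<and> set u = {x. ready T v x \<and> col x = k}"

lemma read_cols_block:
  obtains u where "read_cols F T w = w @ u" "block T True (0 # w) u"
proof -
  let ?P = "\<lambda>c. label F (Col c) \<notin> set w \<and> \<not> (\<exists>r. (r, c) \<in> remaining F w \<and> T (r, c) = 1)"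
  let ?cs = "filter ?P (rev [0..<ncols F])"
  let ?u = "map (\<lambda>c. label F (Col c)) ?cs"
  have "sorted_wrt (\<lambda>c c'. c' < c) (rev [0..<ncols F])" by (simp add: sorted_wrt_rev)
  then have "sorted_wrt (\<lambda>c c'. c' < c) ?cs" by (rule sorted_wrt_filter)
  then have "sorted_wrt (\<lambda>c c'. below True (label F (Col c)) (label F (Col c'))) ?cs"
    by (rule sorted_wrt_mono_rel[rotated]) (auto simp: below_def label_col_less_iff[OF ferrers])
  then have "sorted_wrt (below True) ?u" by (simp add: sorted_wrt_map)
  moreover have "set ?u = {x. ready T (0 # w) x \<and> col x = True}"
  proof (intro equalityI subsetI)
    fix x assume "x \<in> set ?u"
    then obtain c where "c < ncols F" "?P c" "x = label F (Col c)" by auto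
    then show "x \<in> {x. ready T (0 # w) x \<and> col x = True}"
      using ready_col_iff[of c T w] col_label(2)[OF ferrers, of c] by simp
  next
    fix x assume x: "x \<in> {x. ready T (0 # w) x \<and> col x = True}"
    then have "x \<le> n" by (simp add: ready_def)
    then have "ix x < ncols F" "label F (Col (ix x)) = x"
      using x index_less(2)[OF ferrers, of x] label_index(2)[OF ferrers, of x] by auto
    then show "x \<in> set ?u" using x ready_col_iff[of "ix x" T w] by (auto simp: image_iff)
  qed
  ultimately show thesis
    using that[of ?u] by (simp add: block_def read_cols_def concat_map_filter)
qed

lemma read_rows_block:
  assumes T: "T \<in> EW_tableaux F"
  obtains u where "read_rows F T w = w @ u" "block T False (0 # w) u"
proof -
  let ?P = "\<lambda>r. label F (Row r) \<notin> set w \<and> \<not> (\<exists>c. (r, c) \<in> remaining F w \<and> T (r, c) = 0)"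
  let ?rs = "filter ?P (rev [1..<nrows F])"
  let ?u = "map (\<lambda>r. label F (Row r)) ?rs"
  have "sorted_wrt (\<lambda>c c'. c' < c) (rev [1..<nrows F])" by (simp add: sorted_wrt_rev)
  then have "sorted_wrt (\<lambda>c c'. c' < c) ?rs" by (rule sorted_wrt_filter)
  then have "sorted_wrt (\<lambda>r r'. below False (label F (Row r)) (label F (Row r'))) ?rs"
    by (rule sorted_wrt_mono_rel[rotated]) (auto simp: below_def label_row_less_iff[OF ferrers])
  then have "sorted_wrt (below False) ?u" by (simp add: sorted_wrt_map)
  moreover have "set ?u = {x. ready T (0 # w) x \<and> col x = False}"
  proof (intro equalityI subsetI)
    fix x assume "x \<in> set ?u"
    then obtain r where "0 < r" "r < nrows F" "?P r" "x = label F (Row r)"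
      by (auto simp: Suc_le_eq)
    then show "x \<in> {x. ready T (0 # w) x \<and> col x = False}"
      using ready_row_iff[OF T, of r w] row_label(2)[OF ferrers, of r] by simp
  next
    fix x assume x: "x \<in> {x. ready T (0 # w) x \<and> col x = False}"
    then have "x \<le> n" "0 < x" by (auto simp: ready_def)
    then have "ix x < nrows F" "label F (Row (ix x)) = x" "0 < ix x"
      using x index_less(1)[OF ferrers, of x] label_index(1)[OF ferrers, of x]
        row_index_less_iff[OF ferrers, of 0 x] index_top[OF ferrers] not_col_0 by auto
    then have "ix x \<in> set ?rs" using x ready_row_iff[OF T, of "ix x" w] by simp
    then have "label F (Row (ix x)) \<in> set ?u" unfolding set_map by (rule imageI)
    then show "x \<in> set ?u" using \<open>label F (Row (ix x)) = x\<close> by simp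
  qed
  ultimately show thesis
    using that[of ?u] by (simp add: block_def read_rows_def concat_map_filter)
qed

text \<open>
  The invariant before a half-round that reads lines of kind \<open>k\<close>. The word is compatible
  with the arrows, no line of the other kind is ready, and each ready line may follow the last
  letter without violating the zigzag condition.
\<close>

definition reading :: "filling \<Rightarrow> bool \<Rightarrow> nat list \<Rightarrow> bool" where
  "reading T k v \<longleftrightarrow> v \<noteq> [] \<and> v ! 0 = 0 \<and> distinct v \<and> set v \<subseteq> {..n} \<and> zigzag v \<and>
     sorted_wrt (\<lambda>x y. \<not> arrow T y x) v \<and>
     (\<forall>x y. x \<in> set v \<and> y \<notin> set v \<longrightarrow> \<not> arrow T y x) \<and>
     (\<forall>x. ready T v x \<longrightarrow> col x = k \<and> below k (last v) x)"

lemma reading_start: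
  assumes T: "T \<in> EW_tableaux F"
  shows "reading T True [0]"
  unfolding reading_def
proof (intro conjI allI impI)
  fix x assume x: "ready T [0] x"
  then have x': "x \<noteq> 0" "x \<le> n" "\<not> (\<exists>y. y \<notin> {0} \<and> arrow T y x)"
    unfolding ready_def by simp_all
  show "col x = True"
  proof (rule ccontr)
    assume "col x \<noteq> True"
    then obtain b where "b \<noteq> 0" "arrow T b x"
      using EW_arrow_into_row[OF T _ x'(2)] x'(1) by auto
    then show False using x'(3) by (metis singletonD)
  qed
  show "below True (last [0]) x" using x by (auto simp: ready_def below_def)
qed (use EW_arrow_from_top[OF T] in \<open>auto simp: zigzag_def\<close>)

text \<open>
  Reading the block leaves no line of kind \<open>k\<close> ready, as only lines of the other kind have
  arrows into it. A line of the other kind that becomes ready was held back by some \<open>z\<close> in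
  the block, so it forms a cell with \<open>z\<close>; the last letter of the block is at least as far on
  that side as \<open>z\<close>, so the zigzag condition holds there too.
\<close>

lemma reading_step:
  assumes v: "reading T k v" and u: "block T k v u"
  shows "reading T (\<not> k) (v @ u)"
proof -
  have v': "v \<noteq> []" "v ! 0 = 0" "distinct v" "set v \<subseteq> {..n}" "zigzag v"
    "sorted_wrt (\<lambda>x y. \<not> arrow T y x) v"
    "\<And>x y. x \<in> set v \<Longrightarrow> y \<notin> set v \<Longrightarrow> \<not> arrow T y x"
    "\<And>x. ready T v x \<Longrightarrow> col x = k \<and> below k (last v) x"
    using v unfolding reading_def by blast+
  have su: "sorted_wrt (below k) u" and setu: "\<And>x. x \<in> set u \<longleftrightarrow> ready T v x"
    using u v'(8) by (auto simp: block_def)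
  have inu: "x \<le> n" "x \<notin> set v" "col x = k" "\<And>y. y \<notin> set v \<Longrightarrow> \<not> arrow T y x" "below k (last v) x"
    if "x \<in> set u" for x
    using that setu v'(8) by (auto simp: ready_def)
  have "distinct u"
    using sorted_wrt_nth_less[OF su] by (metis below_irrefl distinct_conv_nth nat_neq_iff)
  then have dist: "distinct (v @ u)" using v'(3) inu(2) by auto
  have "successively (\<lambda>x y. below (col y) x y) u"
    by (rule successively_mono[OF successively_if_sorted_wrt[OF su]]) (use inu(3) in simp)
  moreover have "u \<noteq> [] \<Longrightarrow> below (col (hd u)) (last v) (hd u)" using inu(3,5)[of "hd u"] by simp
  ultimately have zz: "zigzag (v @ u)"
    using v'(1,5) unfolding zigzag_successively successively_append_iff by blast
  have same: "\<not> arrow T y x" if "x \<in> set u" "y \<in> set u" for x y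
    using inu(3)[OF that(1)] inu(3)[OF that(2)] by (auto simp: arrow_def cell_pair_def)
  have "sorted_wrt (\<lambda>x y. \<not> arrow T y x) u"
    by (rule sorted_wrt_mono_rel[OF same su])
  then have arrows: "sorted_wrt (\<lambda>x y. \<not> arrow T y x) (v @ u)"
    using v'(6,7) inu(2) by (simp add: sorted_wrt_append)
  have closed: "\<not> arrow T y x" if "x \<in> set (v @ u)" "y \<notin> set (v @ u)" for x y
    using that v'(7)[of x y] inu(4)[of x y] by auto
  have next_block: "col x = (\<not> k) \<and> below (\<not> k) (last (v @ u)) x" if x: "ready T (v @ u) x" for x
  proof -
    have x': "x \<le> n" "x \<notin> set v" "x \<notin> set u" using x by (auto simp: ready_def)
    \<comment> \<open>The line \<open>z\<close> held \<open>x\<close> back, and it must have been read with the block.\<close>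
    then obtain z where z: "z \<notin> set v" "arrow T z x" using setu unfolding ready_def by blast
    then have zu: "z \<in> set u" using x by (auto simp: ready_def)
    then have col_x: "col x = (\<not> k)" using z inu(3) by (auto simp: arrow_def cell_pair_def)
    then have xz: "below k x z" using z(2) by (simp add: arrow_def cell_pair_def below_flip)
    have "z = last u \<or> below k z (last u)"
    proof -
      obtain i where i: "i < length u" "u ! i = z" using zu by (auto simp: in_set_conv_nth)
      have l: "last u = u ! (length u - 1)" using i by (intro last_conv_nth) auto
      show ?thesis
        using sorted_wrt_nth_less[OF su, of i "length u - 1"] i l
        by (cases "i = length u - 1") auto
    qed
    then have "below k x (last u)" using xz below_trans by blast
    moreover have "last (v @ u) = last u" using zu by (cases "u = []") auto
    ultimately show ?thesis using col_x by (simp add: below_flip)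
  qed
  have "set (v @ u) \<subseteq> {..n}" using v'(4) inu(1) by auto
  then show ?thesis
    unfolding reading_def using v'(1,2) dist zz arrows closed next_block
    by (auto simp: nth_append)
qed

lemma reading_progress:
  assumes T: "T \<in> EW_tableaux F" and v: "reading T k v" and u: "block T k v u"
    and x: "x \<le> n" "x \<notin> set v"
  shows "u \<noteq> []"
proof -
  obtain y where "y \<in> {..n} - set v" "\<forall>z\<in>{..n} - set v. \<not> arrow T z y"
    using EW_source_exists[OF T, of "{..n} - set v"] x by auto
  then have "ready T v y" by (auto simp: ready_def arrow_def cell_pair_def)
  moreover from this have "col y = k" using v by (auto simp: reading_def)
  ultimately have "y \<in> set u" using u by (simp add: block_def)
  then show ?thesis by auto
qed

text \<open>
  Each round of the loop consists of two half-rounds, the first of which reads at least one line.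
\<close>

lemma Psi_reading:
  assumes T: "T \<in> EW_tableaux F"
  shows "reading T True (0 # Psi (F, T)) \<and> n \<le> length (Psi (F, T))"
proof -
  have step: "reading T True (0 # read_rows F T (read_cols F T w)) \<and>
      length w < length (read_rows F T (read_cols F T w))"
    if w: "reading T True (0 # w)" "length w < n" for w
  proof -
    obtain u where u: "read_cols F T w = w @ u" "block T True (0 # w) u" by (rule read_cols_block)
    obtain u' where u': "read_rows F T (w @ u) = (w @ u) @ u'" "block T False (0 # w @ u) u'"
      by (rule read_rows_block[OF T])
    have "reading T False (0 # w @ u)" using reading_step[OF w(1) u(2)] by simp
    then have "reading T True (0 # (w @ u) @ u')" using reading_step[OF _ u'(2)] by simp
    moreover have "\<exists>x. x \<le> n \<and> x \<notin> set (0 # w)"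
    proof (rule ccontr)
      assume "\<not> ?thesis"
      then have "{..n} \<subseteq> set (0 # w)" by auto
      then have "card {..n} \<le> card (set (0 # w))" by (intro card_mono) auto
      also have "\<dots> \<le> length (0 # w)" by (rule card_length)
      finally show False using w(2) by simp
    qed
    then have "u \<noteq> []" using reading_progress[OF T w(1) u(2)] by blast
    ultimately show ?thesis using u(1) u'(1) by simp
  qed
  show ?thesis
    unfolding Psi_def case_prod_conv
  proof (rule while_rule[where P = "\<lambda>w. reading T True (0 # w)" and r = "measure (\<lambda>w. n - length w)"])
    show "reading T True (0 # [])" using reading_start[OF T] .
  qed (use step in \<open>auto simp: diff_less_mono2\<close>)
qed

lemma arrow_iff_before:
  assumes v: "rooted_perm v" "sorted_wrt (\<lambda>x y. \<not> arrow T y x) v" and c: "cell_pair x y"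
  shows "arrow T x y \<longleftrightarrow> before v x y"
proof -
  have *: "\<not> arrow T b a" if "before v a b" for a b
    using that sorted_wrt_nth_less[OF v(2)] unfolding before_def by blast
  have "x \<in> set v" "y \<in> set v" "x \<noteq> y" "distinct v"
    using v(1) c by (auto simp: rooted_perm_def cell_pair_def)
  then show ?thesis using *[of x y] *[of y x] before_total[of x v y] arrow_flip[OF c] by blast
qed

lemma Psi_border_word:
  assumes T: "T \<in> EW_tableaux F"
  shows "0 # Psi (F, T) \<in> border_words"
    "\<And>a b. \<not> col a \<Longrightarrow> col b \<Longrightarrow> a < b \<Longrightarrow> b \<le> n \<Longrightarrow>
       T (ix a, ix b) = 1 \<longleftrightarrow> before (0 # Psi (F, T)) a b"
proof -
  let ?v = "0 # Psi (F, T)"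
  have r: "distinct ?v" "set ?v \<subseteq> {..n}" "zigzag ?v" "sorted_wrt (\<lambda>x y. \<not> arrow T y x) ?v" "Suc n \<le> length ?v"
    using Psi_reading[OF T] unfolding reading_def by auto
  have p: "rooted_perm ?v" using rooted_permI[OF r(1,2,5)] by simp
  then show "?v \<in> border_words" using r(3) by (simp add: border_words_def)
  fix a b assume ab: "\<not> col a" "col b" "a < b" "b \<le> n"
  then have "cell_pair a b" by (auto simp: cell_pair_def below_def)
  then show "T (ix a, ix b) = 1 \<longleftrightarrow> before ?v a b"
    using arrow_iff_before[OF p r(4)] arrow_into_col[of a b T] ab by simp
qed

definition order_tableau :: "nat list \<Rightarrow> filling" where
  "order_tableau v = restrict (\<lambda>(r, c). if before v (label F (Row r)) (label F (Col c)) then 1 else 0) (cells F)"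

text \<open>
  A forbidden rectangle would be a cycle in the linear order of the word. A row other than the top
  one contains a 0 because it comes after its parent, which is a column meeting it.
\<close>

lemma order_tableau_EW:
  assumes "v \<in> border_words"
  shows "order_tableau v \<in> EW_tableaux F"
proof -
  have v: "rooted_perm v" "zigzag v" using assms by (auto simp: border_words_def)
  then have dist: "distinct v" and set: "set v = {..n}" by (auto simp: rooted_perm_def)
  let ?T = "order_tableau v"
  have T: "?T (r, c) = (if before v (label F (Row r)) (label F (Col c)) then 1 else 0)"
    if "(r, c) \<in> cells F" for r c
    using that by (simp add: order_tableau_def)
  have total: "before v (label F (Col c)) (label F (Row r))"
    if "(r, c) \<in> cells F" "\<not> before v (label F (Row r)) (label F (Col c))" for r c
    using before_total[of "label F (Row r)" v "label F (Col c)"] that set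
      cellD[OF ferrers that(1)] row_label(1)[OF ferrers] col_label(1)[OF ferrers] by auto
  have top: "?T (0, c) = 1" if c: "c < ncols F" for c
  proof -
    have cell: "(0, c) \<in> cells F" using c ferrersD(1)[OF ferrers] by (simp add: cells_def ncols_def)
    obtain i where i: "i \<le> n" "v ! i = label F (Col c)"
      by (rule rooted_perm_index[OF v(1) col_label(1)[OF ferrers c]])
    have "v ! 0 = 0" using v by (simp add: rooted_perm_def)
    moreover have "label F (Col c) \<noteq> 0" using col_label(2)[OF ferrers c] not_col_0 by metis
    ultimately have "0 < i" using i by (cases i) auto
    then have "before v (v ! 0) (v ! i)" using before_nthI[of 0 i v] i v by (simp add: rooted_perm_def)
    then show ?thesis using T[OF cell] i \<open>v ! 0 = 0\<close> label_top_row[OF ferrers] by simp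
  qed
  have zero: "\<exists>c<F ! r. ?T (r, c) = 0" if r: "0 < r" "r < nrows F" for r
  proof -
    note lab = row_label[OF ferrers r(2)]
    obtain i where i: "i \<le> n" "v ! i = label F (Row r)" by (rule rooted_perm_index[OF v(1) lab(1)])
    have "v ! 0 = 0" using v by (simp add: rooted_perm_def)
    moreover have "label F (Row r) \<noteq> 0" using lab(3) index_top[OF ferrers] r(1) by (metis less_irrefl)
    ultimately have i0: "0 < i" using i by (cases i) auto
    obtain j where j: "parent_at v i j" using parent_at_exists[OF assms i0 i(1)] by blast
    have ji: "j < i" "v ! i < v ! j" using j i lab(2) by (auto simp: parent_at_def below_def)
    have b: "v ! j \<le> n" "col (v ! j)"
      using parent_at_kind[OF assms i0 i(1) j] rooted_perm_nth_le[OF v(1), of j] ji i lab(2) by auto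
    have cell: "(r, ix (v ! j)) \<in> cells F"
      using index_cell_iff[OF ferrers lab(1) b(1) lab(2) b(2)] lab(3) ji i by simp
    have "before v (v ! j) (v ! i)"
      using before_nthI[OF ji(1), of v] i(1) v by (simp add: rooted_perm_def)
    then have "\<not> before v (v ! i) (v ! j)" by (rule before_asym[OF dist])
    then have "?T (r, ix (v ! j)) = 0"
      using T[OF cell] i label_index(2)[OF ferrers b] by simp
    then show ?thesis using cell by (auto simp: cells_def)
  qed
  have rect: "\<not> (?T (r, c) = 0 \<and> ?T (r', c') = 0 \<and> ?T (r, c') = 1 \<and> ?T (r', c) = 1) \<and>
        \<not> (?T (r, c) = 1 \<and> ?T (r', c') = 1 \<and> ?T (r, c') = 0 \<and> ?T (r', c) = 0)"
    if rc: "r < r'" "c < c'" "(r', c') \<in> cells F" for r r' c c'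
  proof -
    have "F ! r' \<le> F ! r" using ferrersD(2)[OF ferrers, of r r'] rc by (auto simp: cells_def)
    then have cs: "(r, c) \<in> cells F" "(r, c') \<in> cells F" "(r', c) \<in> cells F"
      using rc by (auto simp: cells_def)
    have val: "(?T (p, q) = 0 \<longrightarrow> before v (label F (Col q)) (label F (Row p))) \<and>
        (?T (p, q) = 1 \<longrightarrow> before v (label F (Row p)) (label F (Col q)))"
      if "(p, q) \<in> cells F" for p q
      using T[OF that] total[OF that] by simp
    note vals = val[OF cs(1)] val[OF cs(2)] val[OF cs(3)] val[OF rc(3)]
    show ?thesis using vals before_trans[OF dist] before_asym[OF dist] by meson
  qed
  have "?T \<in> cells F \<rightarrow>\<^sub>E {0, 1}"
    unfolding order_tableau_def by (simp add: PiE_iff split_beta)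
  moreover have "\<forall>c<ncols F. ?T (0, c) = 1" using top by blast
  moreover have "\<forall>r. 0 < r \<and> r < nrows F \<longrightarrow> (\<exists>c<F ! r. ?T (r, c) = 0)" using zero by blast
  ultimately show ?thesis
    unfolding EW_tableaux_def using rect by simp
qed

lemma Psi_order_tableau:
  assumes "v \<in> border_words"
  shows "0 # Psi (F, order_tableau v) = v"
proof (rule border_word_eqI[OF Psi_border_word(1)[OF order_tableau_EW[OF assms]] assms])
  fix a b assume ab: "\<not> col a" "col b" "a < b" "b \<le> n"
  then have "order_tableau v (ix a, ix b) = 1 \<longleftrightarrow> before v a b"
    using index_cell_iff[OF ferrers, of a b] label_index[OF ferrers, of a] label_index[OF ferrers, of b]
    by (simp add: order_tableau_def)
  then show "before (0 # Psi (F, order_tableau v)) a b \<longleftrightarrow> before v a b"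
    using Psi_border_word(2)[OF order_tableau_EW[OF assms] ab] by simp
qed

lemma Psi_bij: "bij_betw (\<lambda>T. 0 # Psi (F, T)) (EW_tableaux F) border_words"
proof (rule bij_betw_imageI)
  show "inj_on (\<lambda>T. 0 # Psi (F, T)) (EW_tableaux F)"
  proof (rule inj_onI)
    fix S T assume S: "S \<in> EW_tableaux F" and T: "T \<in> EW_tableaux F"
      and eq: "0 # Psi (F, S) = 0 # Psi (F, T)"
    show "S = T"
    proof (rule PiE_ext[OF EW_tableauxD(1)[OF S] EW_tableauxD(1)[OF T]])
      fix x assume x: "x \<in> cells F"
      obtain r c where rc: "x = (r, c)" by (cases x)
      have l: "r < nrows F" "c < ncols F" "label F (Row r) < label F (Col c)"
        using cellD[OF ferrers] x rc by auto
      have "S (r, c) = 1 \<longleftrightarrow> T (r, c) = 1"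
        using Psi_border_word(2)[OF S _ _ l(3)] Psi_border_word(2)[OF T _ _ l(3)] eq
          row_label[OF ferrers l(1)] col_label[OF ferrers l(2)] by simp
      then show "S x = T x" using EW_value[OF S, of r c] EW_value[OF T, of r c] x rc by auto
    qed
  qed
  show "(\<lambda>T. 0 # Psi (F, T)) ` EW_tableaux F = border_words"
    using Psi_border_word(1) order_tableau_EW Psi_order_tableau by (auto simp: image_iff) metis
qed

lemma is_col_border_word:
  assumes v: "v \<in> border_words" and a: "a \<le> n"
  shows "col a \<longleftrightarrow> (\<exists>i. Suc i < length v \<and> v ! Suc i = a \<and> v ! i < a)"
proof -
  have p: "rooted_perm v" "zigzag v" using v by (auto simp: border_words_def)
  then have len: "length v = Suc n" by (simp add: rooted_perm_def)
  obtain j where j: "j \<le> n" "v ! j = a" by (rule rooted_perm_index[OF p(1) a])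
  show ?thesis
  proof (cases j)
    case 0
    then have "a = 0" using j p by (simp add: rooted_perm_def)
    then show ?thesis using not_col_0 by simp
  next
    case (Suc i)
    have "below (col (v ! Suc i)) (v ! i) (v ! Suc i)"
      using p(2) j(1) len Suc by (simp add: zigzag_def)
    then have iff: "col a \<longleftrightarrow> v ! i < a"
      using j(2) Suc by (auto simp: below_def split: if_splits)
    have uniq: "i' = i" if "Suc i' < length v" "v ! Suc i' = a" for i'
      using rooted_perm_nth_inj[OF p(1), of "Suc i'" j] that j len Suc by simp
    have "Suc i < length v" "v ! Suc i = a" using j len Suc by simp_all
    then show ?thesis using iff uniq by metis
  qed
qed

end

section \<open>The map \<open>M\<close>\<close>

text \<open>
  The word shows which labels are columns, hence the shape; for a fixed shape the word determines
  the tableau.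
\<close>

lemma Psi_inj_on_size: "inj_on Psi (EW_tableaux_of_size m)"
proof (rule inj_onI, clarify)
  fix F S G T
  assume "(F, S) \<in> EW_tableaux_of_size m" "(G, T) \<in> EW_tableaux_of_size m"
    and eq: "Psi (F, S) = Psi (G, T)"
  then have F: "ferrers F" "tab_size F = m" "S \<in> EW_tableaux F"
    and G: "ferrers G" "tab_size G = m" "T \<in> EW_tableaux G"
    by (auto simp: EW_tableaux_of_size_def)
  interpret F: ferrers_shape F by unfold_locales (rule F(1))
  interpret G: ferrers_shape G by unfold_locales (rule G(1))
  have "F = G"
    using ferrers_eqI[OF F(1) G(1)] F(2) G(2) eq
      F.is_col_border_word[OF F.Psi_border_word(1)[OF F(3)]]
      G.is_col_border_word[OF G.Psi_border_word(1)[OF G(3)]] by simp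
  moreover from this have "S = T"
    using inj_onD[OF bij_betw_imp_inj_on[OF F.Psi_bij], of S T] eq F(3) G(3) by simp
  ultimately show "F = G \<and> S = T" by simp
qed

theorem theorem7p10:
  fixes F :: "nat list"
  assumes "ferrers F"
  shows "bij_betw (M F) (tree_tableaux F) ({F} \<times> EW_tableaux F)"
proof -
  interpret ferrers_shape F by unfold_locales (rule assms)
  let ?psi = "\<lambda>T. 0 # Psi (F, T)"
  let ?inv = "inv_into (EW_tableaux F) ?psi"
  have inv: "bij_betw ?inv border_words (EW_tableaux F)" by (rule bij_betw_inv_into[OF Psi_bij])
  have M: "M F D = (F, ?inv (0 # tau F D))" if D: "D \<in> tree_tableaux F" for D
  proof -
    let ?T = "?inv (0 # tau F D)"
    have w: "0 # tau F D \<in> border_words" using bij_betwE[OF tau_bij] D by blast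
    have "?T \<in> EW_tableaux F" using bij_betwE[OF inv] w by blast
    then have "(F, ?T) \<in> EW_tableaux_of_size n" using assms by (simp add: EW_tableaux_of_size_def)
    moreover have "Psi (F, ?T) = tau F D" using bij_betw_inv_into_right[OF Psi_bij w] by simp
    ultimately show ?thesis
      using inv_into_f_f[OF Psi_inj_on_size] by (metis M_def Psi_inv_def)
  qed
  have "bij_betw (Pair F) (EW_tableaux F) ({F} \<times> EW_tableaux F)"
    by (auto simp: bij_betw_def inj_on_def)
  from bij_betw_trans[OF bij_betw_trans[OF tau_bij inv] this]
  have "bij_betw (Pair F \<circ> (?inv \<circ> (\<lambda>D. 0 # tau F D))) (tree_tableaux F) ({F} \<times> EW_tableaux F)" .
  moreover have "bij_betw (M F) (tree_tableaux F) ({F} \<times> EW_tableaux F) \<longleftrightarrow>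
      bij_betw (Pair F \<circ> (?inv \<circ> (\<lambda>D. 0 # tau F D))) (tree_tableaux F) ({F} \<times> EW_tableaux F)"
    by (rule bij_betw_cong) (simp add: M)
  ultimately show ?thesis by simp
qed

end
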